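(* Let $A$ be a natural Banach function algebra on a compact metric space $X$ such that for any pair of disjoint closed subsets $F$ and $K$ of $X$ there exists a function $h\in A$ with values in $[0,1]$ satisfying $h=0$ on $F$ and $h=1$ on $K$. Let $\varphi\colon A\to\mathbb{C}$ be a (not necessarily linear) multiplicative spectral function. If either $\varphi$ is continuous or $1\notin\mathrm{span}(\ker(\varphi))$, then there exists a point $x_0\in X$ such that $\varphi(f)=f(x_0)$ for all $f\in G(A)$ and for all $f\in A$ with $\overline{f}\in A$.
   Context: For a compact Hausdorff space $X$, $C(X)$ is the algebra of continuous complex-valued functions on $X$. A Banach function algebra on $X$ is a subalgebra $A$ of $C(X)$ that separates the points of $X$, contains the constant functions, and is a Banach algebra under some norm $\|\cdot\|$. It is natural if every character of $A$ is evaluation at some point of $X$; then $\sigma(f)=f(X)$ for all $f\in A$, where $\sigma(f)$ is the spectrum of $f$ in $A$. $G(A)$ denotes the group of invertible elements of $A$. A function $\varphi\colon A\to\mathbb{C}$ is spectral if $\varphi(f)\in\sigma(f)$ for all $f\in A$, and multiplicative if $\varphi(fg)=\varphi(f)\varphi(g)$ for all $f,g\in A$. Here $\ker(\varphi)=\{f\in A:\varphi(f)=0\}$, and $\mathrm{span}$ is the complex linear span. Continuity of $\varphi$ is with respect to the norm of $A$. *)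

theory Defs
  imports "HOL-Analysis.Analysis" "HOL-Library.Function_Algebras"
begin

text \<open>
  The space is the whole of a topological type, whose compactness is assumed in the locale
  below. Complex functions on it carry the pointwise operations (including \<open>0\<close> and \<open>1\<close>) of
  \<open>Function_Algebras\<close>; only the complex scalar multiplication has to be added.
\<close>

definition fun_scale :: "complex \<Rightarrow> ('a \<Rightarrow> complex) \<Rightarrow> 'a \<Rightarrow> complex"
  where "fun_scale c f = (\<lambda>x. c * f x)"

interpretation cfun: vector_space "fun_scale :: complex \<Rightarrow> ('a \<Rightarrow> complex) \<Rightarrow> 'a \<Rightarrow> complex"
  by standard (auto simp: fun_scale_def fun_eq_iff algebra_simps)

text \<open>
  The algebra norm \<open>nrm\<close> is unrelated to the uniform norm, and its values outside \<open>A\<close> are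
  irrelevant. The normalisation \<open>nrm 1 = 1\<close> is not required.
\<close>

locale banach_function_algebra =
  fixes A :: "('a::t2_space \<Rightarrow> complex) set"
    and nrm :: "('a \<Rightarrow> complex) \<Rightarrow> real"
  assumes compact_space: "compact (UNIV :: 'a set)"
    and continuous: "f \<in> A \<Longrightarrow> continuous_on UNIV f"
    and subspace: "cfun.subspace A"
    and mult_closed: "f \<in> A \<Longrightarrow> g \<in> A \<Longrightarrow> f * g \<in> A"
    and constants: "(\<lambda>_. c) \<in> A"
    and separates_points: "x \<noteq> y \<Longrightarrow> \<exists>f\<in>A. f x \<noteq> f y"
    and nrm_nonneg: "f \<in> A \<Longrightarrow> 0 \<le> nrm f"
    and nrm_eq_0_iff: "f \<in> A \<Longrightarrow> nrm f = 0 \<longleftrightarrow> f = 0"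
    and nrm_scale: "f \<in> A \<Longrightarrow> nrm (fun_scale c f) = cmod c * nrm f"
    and nrm_triangle: "f \<in> A \<Longrightarrow> g \<in> A \<Longrightarrow> nrm (f + g) \<le> nrm f + nrm g"
    and nrm_mult: "f \<in> A \<Longrightarrow> g \<in> A \<Longrightarrow> nrm (f * g) \<le> nrm f * nrm g"
    and complete: "\<And>u :: nat \<Rightarrow> 'a \<Rightarrow> complex.
      (\<And>n. u n \<in> A) \<Longrightarrow> (\<And>e. e > 0 \<Longrightarrow> \<exists>M. \<forall>m\<ge>M. \<forall>n\<ge>M. nrm (u m - u n) < e)
      \<Longrightarrow> \<exists>f\<in>A. (\<lambda>n. nrm (u n - f)) \<longlonglongrightarrow> 0"

text \<open>
  Functionals on \<open>A\<close> are functions on the whole type of complex functions of which only the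
  values on \<open>A\<close> matter.
\<close>

definition multiplicative_on ::
    "('a \<Rightarrow> complex) set \<Rightarrow> (('a \<Rightarrow> complex) \<Rightarrow> complex) \<Rightarrow> bool"
  where "multiplicative_on A \<phi> \<longleftrightarrow> (\<forall>f\<in>A. \<forall>g\<in>A. \<phi> (f * g) = \<phi> f * \<phi> g)"

definition character_on ::
    "('a \<Rightarrow> complex) set \<Rightarrow> (('a \<Rightarrow> complex) \<Rightarrow> complex) \<Rightarrow> bool"
  where "character_on A \<psi> \<longleftrightarrow>
    (\<forall>f\<in>A. \<forall>g\<in>A. \<psi> (f + g) = \<psi> f + \<psi> g) \<and>
    (\<forall>c. \<forall>f\<in>A. \<psi> (fun_scale c f) = c * \<psi> f) \<and>
    multiplicative_on A \<psi> \<and> (\<exists>f\<in>A. \<psi> f \<noteq> 0)"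

locale natural_banach_function_algebra = banach_function_algebra +
  assumes natural: "character_on A \<psi> \<Longrightarrow> \<exists>x. \<forall>f\<in>A. \<psi> f = f x"

definition invertibles :: "('a \<Rightarrow> complex) set \<Rightarrow> ('a \<Rightarrow> complex) set"
  where "invertibles A = {f \<in> A. \<exists>g\<in>A. f * g = 1}"

definition spectrum :: "('a \<Rightarrow> complex) set \<Rightarrow> ('a \<Rightarrow> complex) \<Rightarrow> complex set"
  where "spectrum A f = {c. f - fun_scale c 1 \<notin> invertibles A}"

definition spectral_on ::
    "('a \<Rightarrow> complex) set \<Rightarrow> (('a \<Rightarrow> complex) \<Rightarrow> complex) \<Rightarrow> bool"
  where "spectral_on A \<phi> \<longleftrightarrow> (\<forall>f\<in>A. \<phi> f \<in> spectrum A f)"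

definition kernel_on ::
    "('a \<Rightarrow> complex) set \<Rightarrow> (('a \<Rightarrow> complex) \<Rightarrow> complex) \<Rightarrow> ('a \<Rightarrow> complex) set"
  where "kernel_on A \<phi> = {f \<in> A. \<phi> f = 0}"

definition norm_continuous_on ::
    "('a \<Rightarrow> complex) set \<Rightarrow> (('a \<Rightarrow> complex) \<Rightarrow> real) \<Rightarrow> (('a \<Rightarrow> complex) \<Rightarrow> complex) \<Rightarrow> bool"
  where "norm_continuous_on A nrm \<phi> \<longleftrightarrow>
    (\<forall>f\<in>A. \<forall>e>0. \<exists>d>0. \<forall>g\<in>A. nrm (g - f) < d \<longrightarrow> cmod (\<phi> g - \<phi> f) < e)"

end

(* Naturality, through the Gelfand-Mazur theorem, makes a non-vanishing element of A invertible
   and gives every proper ideal of A a common zero; in particular phi f is always a value of f.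

   If phi does not vanish at the functions k >= 0 in A with k x0 = 1, then phi f depends only on
   the germ of f at x0, and cutting f off near x0 gives phi f = f x0 for every f in A. If 1 is not
   in span (ker phi), this span is a proper ideal and x0 is a common zero of it.

   If phi is continuous, put L g = ln (phi (exp g)) for real g. The modulus and the argument of
   exp (g + i k / s), with s large, show that L g = g x and L k = k x for a common x. Taking k as
   (g - L g)^2, and adding, finitely many g have a common point with L g = g x, and compactness
   provides one point x0 for all g. Then phi p = p x0 for p > 0, and by continuity for p >= 0. *)
theory Submission
  imports Defs
begin

text \<open>The spectral condition gives each function a point of its own, and as
  \<open>\<phi>\<close> need not be additive, these points cannot be matched by a linear argument.
  Exponentials bring additivity back, since products become sums of exponents, and a unimodular
  factor lets one complex value carry two real equations. They only control functions bounded away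
  from zero, whereas peak functions may vanish somewhere; continuity bridges this gap. Gelfand-Mazur
  concerns the quotient by a maximal ideal, which is no longer given as an algebra of functions. The
  quotient is therefore never formed: its norm is a seminorm on \<open>A\<close>, and equality in
  the quotient means that a difference is null. Averages over roots of unity take the place of
  vector-valued holomorphic functions.\<close>

lemma sum_fun_apply: "(sum f S) x = (\<Sum>i\<in>S. f i x)"
  for f :: "'i \<Rightarrow> 'a \<Rightarrow> 'b::comm_monoid_add"
  by (induction S rule: infinite_finite_induct) auto

lemma power_fun_apply: "(f ^ n) x = f x ^ n"
  for f :: "'a \<Rightarrow> 'b::monoid_mult"
  by (induction n) auto

section \<open>The Gelfand-Mazur theorem for seminorms\<close>

text \<open>Null elements of \<open>q\<close> play the part of zero, so the same locale covers
  \<open>nrm\<close> and the quotient norms. The zero seminorm is allowed; otherwise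
  \<open>q 1\<close> is at least 1 and may exceed it.\<close>

locale seminormed_function_algebra =
  fixes A :: "('a \<Rightarrow> complex) set"
    and q :: "('a \<Rightarrow> complex) \<Rightarrow> real"
  assumes subspace: "cfun.subspace A"
    and mult_closed: "f \<in> A \<Longrightarrow> g \<in> A \<Longrightarrow> f * g \<in> A"
    and constants: "(\<lambda>_. c) \<in> A"
    and seminorm_nonneg: "f \<in> A \<Longrightarrow> 0 \<le> q f"
    and seminorm_scale: "f \<in> A \<Longrightarrow> q (fun_scale c f) = cmod c * q f"
    and seminorm_triangle: "f \<in> A \<Longrightarrow> g \<in> A \<Longrightarrow> q (f + g) \<le> q f + q g"
    and seminorm_mult: "f \<in> A \<Longrightarrow> g \<in> A \<Longrightarrow> q (f * g) \<le> q f * q g"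
begin

lemma zero_closed: "0 \<in> A"
  using subspace cfun.subspace_0 by blast

lemma one_closed: "1 \<in> A"
  using constants[of 1] by (simp add: one_fun_def)

lemma add_closed: "f \<in> A \<Longrightarrow> g \<in> A \<Longrightarrow> f + g \<in> A"
  using subspace cfun.subspace_add by blast

lemma diff_closed: "f \<in> A \<Longrightarrow> g \<in> A \<Longrightarrow> f - g \<in> A"
  using subspace cfun.subspace_diff by blast

lemma scale_closed: "f \<in> A \<Longrightarrow> fun_scale c f \<in> A"
  using subspace cfun.subspace_scale by blast

lemma power_closed: "f \<in> A \<Longrightarrow> f ^ n \<in> A"
  by (induction n) (auto intro: one_closed mult_closed)

lemma sum_closed: "(\<And>i. i \<in> S \<Longrightarrow> f i \<in> A) \<Longrightarrow> sum f S \<in> A"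
  using subspace cfun.subspace_sum by blast

lemmas closed_intros = zero_closed one_closed add_closed diff_closed mult_closed scale_closed
  power_closed sum_closed

lemma seminorm_zero: "q 0 = 0"
  using seminorm_scale[OF zero_closed, of 0] by (simp add: fun_scale_def zero_fun_def)

lemma seminorm_uminus: "f \<in> A \<Longrightarrow> q (- f) = q f"
  using seminorm_scale[of f "-1"] by simp

lemma seminorm_commute: "f \<in> A \<Longrightarrow> g \<in> A \<Longrightarrow> q (f - g) = q (g - f)"
  using seminorm_uminus[of "f - g"] diff_closed by simp

lemma seminorm_diff: "f \<in> A \<Longrightarrow> g \<in> A \<Longrightarrow> q (f - g) \<le> q f + q g"
  using seminorm_triangle[of f "- g"] scale_closed[of g "-1"] by (simp add: seminorm_uminus)

lemma seminorm_diff_ge: "f \<in> A \<Longrightarrow> g \<in> A \<Longrightarrow> \<bar>q f - q g\<bar> \<le> q (f - g)"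
  using seminorm_triangle[of "f - g" g] seminorm_triangle[of "g - f" f]
  by (simp add: diff_closed seminorm_commute[of g f])

lemma seminorm_sum: "(\<And>i. i \<in> S \<Longrightarrow> f i \<in> A) \<Longrightarrow> q (sum f S) \<le> (\<Sum>i\<in>S. q (f i))"
proof (induction S rule: infinite_finite_induct)
  case (insert i S)
  then have "q (f i + sum f S) \<le> q (f i) + q (sum f S)"
    by (intro seminorm_triangle sum_closed) auto
  also have "q (sum f S) \<le> (\<Sum>i\<in>S. q (f i))"
    using insert by blast
  finally show ?case
    using insert by (simp only: sum.insert not_False_eq_True)
qed (auto simp: seminorm_zero)

text \<open>The exponent 0 would need \<open>q 1 \<le> 1\<close>.\<close>

lemma seminorm_power: "f \<in> A \<Longrightarrow> n \<noteq> 0 \<Longrightarrow> q (f ^ n) \<le> q f ^ n"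
proof (induction n)
  case (Suc n)
  show ?case
  proof (cases "n = 0")
    case False
    have "q (f * f ^ n) \<le> q f * q (f ^ n)"
      using Suc by (intro seminorm_mult closed_intros)
    also have "\<dots> \<le> q f * q f ^ n"
      using Suc False by (intro mult_left_mono seminorm_nonneg) auto
    finally show ?thesis by (simp only: power_Suc)
  qed simp
qed simp

lemma seminorm_mult_null: "f \<in> A \<Longrightarrow> g \<in> A \<Longrightarrow> q g = 0 \<Longrightarrow> q (f * g) = 0"
  using seminorm_mult[of f g] seminorm_nonneg[of "f * g"] mult_closed by auto

lemma seminorm_add_null: "f \<in> A \<Longrightarrow> g \<in> A \<Longrightarrow> q f = 0 \<Longrightarrow> q g = 0 \<Longrightarrow> q (f + g) = 0"
  using seminorm_triangle[of f g] seminorm_nonneg[of "f + g"] add_closed by auto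

lemma seminorm_diff_null: "f \<in> A \<Longrightarrow> g \<in> A \<Longrightarrow> q f = 0 \<Longrightarrow> q g = 0 \<Longrightarrow> q (f - g) = 0"
  using seminorm_diff[of f g] seminorm_nonneg[of "f - g"] diff_closed by auto

lemma seminorm_sum_null:
  "(\<And>i. i \<in> S \<Longrightarrow> f i \<in> A) \<Longrightarrow> (\<And>i. i \<in> S \<Longrightarrow> q (f i) = 0) \<Longrightarrow> q (sum f S) = 0"
  using seminorm_sum[of S f] seminorm_nonneg[OF sum_closed, of S f] by auto

text \<open>Replaces rewriting in the quotient: an identity modulo null elements becomes an equality
  of seminorms.\<close>

lemma seminorm_cong: "f \<in> A \<Longrightarrow> g \<in> A \<Longrightarrow> q (f - g) = 0 \<Longrightarrow> q f = q g"
  using seminorm_diff_ge[of f g] by auto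

end

section \<open>Averaging the resolvent over roots of unity\<close>

lemma sum_powers_root_of_unity:
  assumes "j < n"
  shows "(\<Sum>k<n. cis (2 * pi * real k / real n) ^ j) = (if j = 0 then of_nat n else 0)"
proof (cases "j = 0")
  case False
  \<comment> \<open>The sum over \<open>k\<close> is geometric with ratio \<open>z\<close>, the
    \<open>j\<close>-th power of the primitive root, and \<open>z\<close> differs from 1 because
    \<open>0 < j < n\<close>.\<close>
  define z where "z = cis (2 * pi * real j / real n)"
  have n: "n > 0" using assms by simp
  have "z = exp (2 * of_real pi * \<i> * of_nat j / of_nat n)"
    by (simp add: z_def cis_conv_exp mult_ac)
  then have "z \<noteq> 1"
    using complex_root_unity_eq_1[of n j] assms False n by (auto dest: dvd_imp_le)
  have "cis (2 * pi * real k / real n) ^ j = z ^ k" for k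
    by (simp add: z_def Complex.DeMoivre mult_ac)
  moreover have "z ^ n = 1"
    using n by (simp add: z_def Complex.DeMoivre)
  ultimately show ?thesis
    using \<open>z \<noteq> 1\<close> False by (simp add: geometric_sum)
qed simp

context seminormed_function_algebra
begin

text \<open>Here \<open>w l\<close> inverts \<open>1 - l * b\<close> modulo null elements. The
  geometric sum \<open>S k\<close> satisfies
  \<open>(1 - pt k * b) * S k = 1 - r ^ n * b ^ n\<close>, so multiplying \<open>w (pt k)\<close> by
  the latter gives \<open>S k\<close>. The \<open>S k\<close> add up to \<open>n\<close>, as only
  the power 0 survives the summation over roots of unity.\<close>

lemma resolvent_average:
  fixes r :: real
  assumes b: "b \<in> A" and n: "n > 0"
    and w: "\<And>l. w l \<in> A" "\<And>l. q ((1 - fun_scale l b) * w l - 1) = 0"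
  defines "pt \<equiv> \<lambda>k. complex_of_real r * cis (2 * pi * real k / real n)"
  shows "q ((1 - fun_scale (complex_of_real r ^ n) (b ^ n)) *
    fun_scale (1 / of_nat n) (\<Sum>k<n. w (pt k)) - 1) = 0"
proof -
  define S where "S = (\<lambda>k. \<Sum>j<n. fun_scale (pt k) b ^ j)"
  have S: "S k \<in> A" for k
    unfolding S_def using b by (intro closed_intros)
  have pt: "pt k ^ n = complex_of_real r ^ n" for k
    using n by (simp add: pt_def power_mult_distrib Complex.DeMoivre)
  have sumS: "(\<Sum>k<n. S k x) = of_nat n" for x
  proof -
    have "(\<Sum>k<n. S k x) = (\<Sum>k<n. \<Sum>j<n. (pt k * b x) ^ j)"
      by (simp add: S_def sum_fun_apply power_fun_apply fun_scale_def)
    also have "\<dots> = (\<Sum>j<n. \<Sum>k<n. (pt k * b x) ^ j)"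
      by (rule sum.swap)
    also have "\<dots> = (\<Sum>j<n. (of_real r * b x) ^ j *
        (\<Sum>k<n. cis (2 * pi * real k / real n) ^ j))"
      by (simp add: pt_def power_mult_distrib sum_distrib_left mult_ac)
    also have "\<dots> = (\<Sum>j<n. if j = 0 then of_nat n else 0)"
      by (intro sum.cong) (auto simp: sum_powers_root_of_unity)
    finally show ?thesis using n by simp
  qed
  have "(1 - fun_scale (complex_of_real r ^ n) (b ^ n)) *
      fun_scale (1 / of_nat n) (\<Sum>k<n. w (pt k)) - 1
    = fun_scale (1 / of_nat n) (\<Sum>k<n. S k * ((1 - fun_scale (pt k) b) * w (pt k) - 1))"
    (is "?L = ?R")
  proof
    fix x
    have geo: "S k x * (1 - pt k * b x) = 1 - of_real r ^ n * b x ^ n" for k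
    proof -
      have "(1 - pt k * b x) * (\<Sum>j<n. (pt k * b x) ^ j) = 1 - (pt k * b x) ^ n"
        by (rule one_diff_power_eq[symmetric])
      then show ?thesis
        using pt[of k]
        by (simp add: S_def sum_fun_apply power_fun_apply fun_scale_def power_mult_distrib mult.commute)
    qed
    have "?R x = 1 / of_nat n *
        (\<Sum>k<n. S k x * (1 - pt k * b x) * w (pt k) x - S k x)"
      by (simp add: fun_scale_def sum_fun_apply algebra_simps)
    also have "\<dots> = 1 / of_nat n * ((1 - of_real r ^ n * b x ^ n) * (\<Sum>k<n. w (pt k) x) - of_nat n)"
      by (simp only: geo sum_subtractf sumS sum_distrib_left)
    also have "\<dots> = ?L x"
      using n by (simp add: fun_scale_def sum_fun_apply power_fun_apply field_simps)
    finally show "?L x = ?R x" ..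
  qed
  moreover have "q ?R = 0"
  proof -
    have "q (\<Sum>k<n. S k * ((1 - fun_scale (pt k) b) * w (pt k) - 1)) = 0"
      using b S w by (intro seminorm_sum_null seminorm_mult_null closed_intros) auto
    moreover have "(\<Sum>k<n. S k * ((1 - fun_scale (pt k) b) * w (pt k) - 1)) \<in> A"
      using b S w by (intro closed_intros) auto
    ultimately show ?thesis by (simp add: seminorm_scale)
  qed
  ultimately show ?thesis by simp
qed

text \<open>Resolvent identity: modulo null elements, \<open>w l - w m\<close> is
  \<open>(l - m) * b * w l * w m\<close>.\<close>

lemma resolvent_lipschitz:
  assumes b: "b \<in> A"
    and w: "\<And>l. w l \<in> A" "\<And>l. q ((1 - fun_scale l b) * w l - 1) = 0"
  shows "q (w l - w m) \<le> cmod (l - m) * q b * q (w l) * q (w m)"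
proof -
  define p where "p = fun_scale (l - m) (b * (w l * w m))"
  have p: "p \<in> A"
    unfolding p_def by (intro closed_intros b w)
  have "w l - w m - p = w m * ((1 - fun_scale l b) * w l - 1)
      - w l * ((1 - fun_scale m b) * w m - 1)"
    by (simp add: p_def fun_eq_iff fun_scale_def algebra_simps)
  moreover have "q (w m * ((1 - fun_scale l b) * w l - 1)
      - w l * ((1 - fun_scale m b) * w m - 1)) = 0"
    by (intro seminorm_diff_null seminorm_mult_null closed_intros b w)
  ultimately have "q (w l - w m - p) = 0" by simp
  then have "q (w l - w m) = q p"
    using seminorm_cong[of "w l - w m" p] p w by (simp add: diff_closed)
  also have "\<dots> = cmod (l - m) * q (b * (w l * w m))"
    unfolding p_def by (intro seminorm_scale closed_intros b w)
  also have "\<dots> \<le> cmod (l - m) * (q b * (q (w l) * q (w m)))"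
  proof (intro mult_left_mono)
    have "q (b * (w l * w m)) \<le> q b * q (w l * w m)"
      by (intro seminorm_mult closed_intros b w)
    also have "\<dots> \<le> q b * (q (w l) * q (w m))"
      by (intro mult_left_mono seminorm_mult seminorm_nonneg b w)
    finally show "q (b * (w l * w m)) \<le> q b * (q (w l) * q (w m))" .
  qed auto
  finally show ?thesis by (simp add: mult_ac)
qed

text \<open>The estimate of \<open>resolvent_lipschitz\<close> contains the values to be bounded.
  Dividing it by \<open>q (w l) * q (w m)\<close> makes \<open>1 / q (w l)\<close> Lipschitz with
  constant \<open>q b\<close>, and its minimum over the compact disc is positive.\<close>

lemma resolvent_bounded:
  assumes b: "b \<in> A"
    and w: "\<And>l. w l \<in> A" "\<And>l. q ((1 - fun_scale l b) * w l - 1) = 0"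
    and pos: "\<And>l. q (w l) > 0"
  shows "\<exists>K>0. \<forall>l. cmod l \<le> R \<longrightarrow> q (w l) \<le> K"
proof (cases "R \<ge> 0")
  case True
  have lip: "dist (1 / q (w l)) (1 / q (w m)) \<le> q b * dist l m" for l m
  proof -
    have "\<bar>1 / q (w l) - 1 / q (w m)\<bar> = \<bar>q (w l) - q (w m)\<bar> / (q (w l) * q (w m))"
      using pos[of l] pos[of m] by (simp add: diff_divide_eq_iff divide_diff_eq_iff abs_mult abs_minus_commute field_simps)
    also have "\<dots> \<le> q (w l - w m) / (q (w l) * q (w m))"
      using pos[of l] pos[of m] by (intro divide_right_mono seminorm_diff_ge w) auto
    also have "\<dots> \<le> q b * cmod (l - m)"
      using resolvent_lipschitz[OF b w, of l m] pos[of l] pos[of m]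
      by (simp add: divide_le_eq mult_ac)
    finally show ?thesis by (simp add: dist_norm)
  qed
  have "continuous_on (cball 0 R) (\<lambda>l. 1 / q (w l))"
  proof (rule continuous_on_subset[OF _ subset_UNIV])
    have "(q b)-lipschitz_on UNIV (\<lambda>l. 1 / q (w l))"
      using lip seminorm_nonneg[OF b] by (intro lipschitz_onI) auto
    then show "continuous_on UNIV (\<lambda>l. 1 / q (w l))"
      by (rule lipschitz_on_continuous_on)
  qed
  moreover have "cball (0::complex) R \<noteq> {}" using True by simp
  ultimately obtain m where m: "\<And>l. l \<in> cball 0 R \<Longrightarrow> 1 / q (w m) \<le> 1 / q (w l)"
    using continuous_attains_inf[of "cball 0 R"] by (metis compact_cball)
  have "q (w l) \<le> q (w m)" if "cmod l \<le> R" for l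
    using m[of l] that pos[of l] pos[of m] by (simp add: field_simps)
  then show ?thesis using pos[of m] by blast
qed (use zero_less_one norm_ge_zero order.trans in blast)

text \<open>
  If the spectrum of \<open>a\<close> is empty then \<open>1 - l b\<close> is invertible for every \<open>l\<close>, where \<open>b\<close>
  inverts \<open>a\<close>, and its inverse \<open>w l\<close> is Lipschitz on bounded sets. Averaging \<open>w\<close> over \<open>n\<close> equally
  spaced points of the circle of radius \<open>r\<close> inverts \<open>1 - r\<^sup>n b\<^sup>n\<close>. Hence the set \<open>G\<close> of the
  radii \<open>r\<close> at which some \<open>r\<^sup>n b\<^sup>n\<close> is small contains its supremum; but \<open>G\<close> is open to the
  right.
\<close>

lemma gelfand_mazur:
  assumes one: "q 1 \<noteq> 0"
    and field: "\<And>f. f \<in> A \<Longrightarrow> q f \<noteq> 0 \<Longrightarrow> \<exists>g\<in>A. q (f * g - 1) = 0"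
    and a: "a \<in> A"
  shows "\<exists>c. q (a - fun_scale c 1) = 0"
proof (rule ccontr)
  assume contra: "\<nexists>c. q (a - fun_scale c 1) = 0"
  then have "q a \<noteq> 0" by (auto dest: spec[of _ 0])
  then obtain b where b: "b \<in> A" and ab: "q (a * b - 1) = 0"
    using field a by blast
  \<comment> \<open>As \<open>a * b\<close> is 1 modulo null elements, \<open>a - l\<close> agrees
    with \<open>a * (1 - l * b)\<close>.\<close>
  have "q (1 - fun_scale l b) \<noteq> 0" for l
  proof
    assume *: "q (1 - fun_scale l b) = 0"
    have "a - fun_scale l 1 = a * (1 - fun_scale l b) + fun_scale l (a * b - 1)"
      by (simp add: fun_eq_iff fun_scale_def algebra_simps)
    moreover have "q (a * (1 - fun_scale l b) + fun_scale l (a * b - 1)) = 0"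
    proof (rule seminorm_add_null)
      show "q (a * (1 - fun_scale l b)) = 0"
        by (intro seminorm_mult_null * closed_intros a b)
      show "q (fun_scale l (a * b - 1)) = 0"
        using ab by (subst seminorm_scale) (auto intro!: closed_intros a b)
    qed (intro closed_intros a b)+
    ultimately show False using contra by metis
  qed
  then have "\<forall>l. \<exists>g\<in>A. q ((1 - fun_scale l b) * g - 1) = 0"
    using field b by (blast intro: closed_intros)
  then obtain w where w: "\<And>l. w l \<in> A" "\<And>l. q ((1 - fun_scale l b) * w l - 1) = 0"
    by metis
  have q1: "q 1 \<ge> 1"
  proof -
    have "q 1 \<le> q 1 * q 1"
      using seminorm_mult[OF one_closed one_closed] by simp
    then show ?thesis
      using one seminorm_nonneg[OF one_closed] by simp
  qed
  have pos: "q (w l) > 0" for l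
  proof (rule ccontr)
    assume "\<not> q (w l) > 0"
    then have "q (w l) = 0" using seminorm_nonneg[OF w(1)[of l]] by simp
    then have "q ((1 - fun_scale l b) * w l) = 0"
      by (intro seminorm_mult_null closed_intros b w)
    moreover have "q ((1 - fun_scale l b) * w l) = q 1"
      by (intro seminorm_cong closed_intros b w)
    ultimately show False using one by simp
  qed
  define y where "y = (\<lambda>r n. fun_scale (complex_of_real r ^ n) (b ^ n))"
  define v where "v = (\<lambda>r n. fun_scale (1 / of_nat n)
      (\<Sum>k<n. w (complex_of_real r * cis (2 * pi * real k / real n))))"
  have y_mem: "y r n \<in> A" for r n
    unfolding y_def by (intro closed_intros b)
  have v_mem: "v r n \<in> A" for r n
    unfolding v_def by (intro closed_intros w)
  have yv: "q ((1 - y r n) * v r n - 1) = 0" if "n > 0" for r n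
    unfolding y_def v_def using resolvent_average[OF b that w, of r] .
  have qy: "q (y r n) = \<bar>r\<bar> ^ n * q (b ^ n)" for r n
    unfolding y_def by (subst seminorm_scale) (auto intro: closed_intros b simp: norm_power)
  \<comment> \<open>With the spectral radius of \<open>b\<close> as the infimum of the
    \<open>n\<close>-th roots of \<open>q (b ^ n)\<close>, these are the \<open>r \<ge> 0\<close>
    whose product with it is below 1.\<close>
  define G where "G = {r. r \<ge> 0 \<and> (\<exists>n>0. q (y r n) < 1)}"
  have "0 \<in> G"
    by (auto simp: G_def qy intro!: exI[of _ 1])
  \<comment> \<open>\<open>a ^ n * b ^ n\<close> is 1 modulo null elements, so
    \<open>1 \<le> q a ^ n * q (b ^ n)\<close>, which rules out radii above
    \<open>q a\<close>.\<close>
  have G_le: "r \<le> q a" if "r \<in> G" for r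
  proof (rule ccontr)
    assume "\<not> r \<le> q a"
    from that obtain n where n: "n > 0" "q (y r n) < 1" and r: "r \<ge> 0"
      by (auto simp: G_def)
    have eq: "q ((a * b) ^ n - 1) = 0"
    proof -
      have "(a * b) ^ n - 1 = (\<Sum>j<n. (a * b) ^ j) * (a * b - 1)"
        using power_diff_1_eq[of "(a * b) x" n for x]
        by (simp add: fun_eq_iff sum_fun_apply power_fun_apply mult.commute)
      moreover have "q ((\<Sum>j<n. (a * b) ^ j) * (a * b - 1)) = 0"
        using ab by (intro seminorm_mult_null closed_intros a b)
      ultimately show ?thesis by simp
    qed
    have "q 1 = q ((a * b) ^ n)"
      using eq by (intro seminorm_cong[symmetric] closed_intros a b)
    also have "\<dots> = q (a ^ n * b ^ n)"
      by (simp add: power_mult_distrib)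
    also have "\<dots> \<le> q (a ^ n) * q (b ^ n)"
      by (intro seminorm_mult closed_intros a b)
    also have "\<dots> \<le> q a ^ n * q (b ^ n)"
      using n by (intro mult_right_mono seminorm_power seminorm_nonneg closed_intros a b) auto
    also have "\<dots> \<le> r ^ n * q (b ^ n)"
      using \<open>\<not> r \<le> q a\<close> seminorm_nonneg[OF a]
      by (intro mult_right_mono power_mono seminorm_nonneg closed_intros b) (auto intro: a)
    also have "\<dots> < 1"
      using n r by (simp add: qy)
    finally show False using q1 by simp
  qed
  define R where "R = Sup G"
  have bdd: "bdd_above G" using G_le by (auto intro!: bdd_aboveI)
  have R_ge: "r \<le> R" if "r \<in> G" for r
    unfolding R_def using that bdd by (rule cSup_upper)
  have R0: "R \<ge> 0" using R_ge \<open>0 \<in> G\<close> .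
  have "R \<notin> G"
  proof
    assume "R \<in> G"
    then obtain n where n: "n > 0" "R ^ n * q (b ^ n) < 1"
      using R0 by (auto simp: G_def qy)
    have "((\<lambda>r. r ^ n * q (b ^ n)) \<longlongrightarrow> R ^ n * q (b ^ n)) (at_right R)"
      by (intro tendsto_intros)
    then have "eventually (\<lambda>r. r ^ n * q (b ^ n) < 1) (at_right R)"
      using n(2) by (rule order_tendstoD)
    moreover have "eventually (\<lambda>r. r > R) (at_right R)"
      by (simp add: eventually_at_right_less)
    ultimately have "eventually (\<lambda>r. r ^ n * q (b ^ n) < 1 \<and> r > R) (at_right R)"
      by (rule eventually_conj)
    then obtain r where r: "r ^ n * q (b ^ n) < 1" "r > R"
      using eventually_happens'[OF trivial_limit_at_right_real] by blast
    then have "r \<in> G"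
      using R0 n(1) by (auto simp: G_def qy)
    then show False using R_ge r by fastforce
  qed
  moreover have "R \<in> G"
  proof -
    \<comment> \<open>Chosen so that \<open>q (v R n - 1) \<le> e\<close> leads to
      \<open>q (y R n) \<le> 1/4 + 1/4 * q (y R n)\<close>, hence to a value below 1.\<close>
    define e where "e = 1 / (4 * q 1)"
    have e: "e > 0" "e \<le> 1/4" "e * q 1 = 1/4"
      using q1 by (auto simp: e_def field_simps)
    obtain K where K: "K > 0" "\<And>l. cmod l \<le> R \<Longrightarrow> q (w l) \<le> K"
      using resolvent_bounded[of b w R] b w pos by blast
    have qb: "q b \<ge> 0" using seminorm_nonneg[OF b] .
    \<comment> \<open>A Lipschitz constant of \<open>w\<close> on the disc of radius
      \<open>R\<close>; \<open>q b + 1\<close> instead of \<open>q b\<close> keeps it positive for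
      the division in \<open>d\<close>.\<close>
    define s where "s = (q b + 1) * K * K"
    have s: "s > 0" using K qb by (simp add: s_def)
    define d where "d = e / 2 / s"
    have d: "d > 0" using e s by (simp add: d_def)
    obtain r where r: "r \<in> G" "r > R - d"
    proof -
      have "R - d < Sup G" using d by (simp add: R_def)
      then show ?thesis
        using that \<open>0 \<in> G\<close> by (metis less_cSup_iff bdd empty_iff)
    qed
    have r0: "0 \<le> r" "r \<le> R" using r R_ge by (auto simp: G_def)
    obtain N where N: "N > 0" "q (y r N) < 1"
      using r by (auto simp: G_def)
    have "(\<lambda>j. q (y r N) ^ j) \<longlonglongrightarrow> 0"
      using N(2) seminorm_nonneg[OF y_mem] by (intro LIMSEQ_realpow_zero)
    then have "eventually (\<lambda>j. q (y r N) ^ j < e / (4 * (q 1 + 1))) sequentially"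
      using e q1 by (intro order_tendstoD(2)[of _ 0]) auto
    then have "eventually (\<lambda>j. q (y r N) ^ j < e / (4 * (q 1 + 1)) \<and> j > 0) sequentially"
      using eventually_gt_at_top eventually_conj by blast
    then obtain j where j: "q (y r N) ^ j < e / (4 * (q 1 + 1))" "j > 0"
      using eventually_happens' sequentially_bot by blast
    \<comment> \<open>Taking the \<open>j\<close>-th power of \<open>y r N\<close> makes it small,
      at the price of an \<open>n\<close> that depends on \<open>r\<close>.\<close>
    define n where "n = N * j"
    have n: "n > 0" using N j by (simp add: n_def)
    have "y r n = y r N ^ j"
      by (simp add: y_def n_def fun_eq_iff fun_scale_def power_fun_apply power_mult power_mult_distrib)
    then have yr: "q (y r n) < e / (4 * (q 1 + 1))"
      using seminorm_power[OF y_mem, of j r N] j by simp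
    \<comment> \<open>\<open>v = 1 + y v\<close> modulo null elements, so a small \<open>y\<close> forces \<open>v\<close> to be close to \<open>1\<close>.\<close>
    have vr: "q (v r n - 1) \<le> e / 2"
    proof -
      have "q (v r n - 1) = q (y r n * v r n)"
      proof (rule seminorm_cong)
        have "v r n - 1 - y r n * v r n = (1 - y r n) * v r n - 1"
          by (simp add: algebra_simps)
        then show "q (v r n - 1 - y r n * v r n) = 0" using yv[OF n, of r] by metis
      qed (intro closed_intros y_mem v_mem)+
      also have "\<dots> \<le> q (y r n) * q (v r n)"
        by (intro seminorm_mult y_mem v_mem)
      finally have 1: "q (v r n - 1) \<le> q (y r n) * q (v r n)" .
      have 2: "q (v r n) \<le> q (v r n - 1) + q 1"
        using seminorm_triangle[of "v r n - 1" 1] v_mem by (simp add: closed_intros)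
      have 3: "q (y r n) \<le> 1/2"
      proof -
        have "e / (4 * (q 1 + 1)) \<le> e / 1"
          using e q1 by (intro divide_left_mono) auto
        then show ?thesis using yr e by simp
      qed
      have "q (y r n) * q (v r n) \<le> 1/2 * q (v r n)"
        using 3 by (intro mult_right_mono seminorm_nonneg v_mem)
      then have "q (v r n) \<le> 2 * q 1" using 1 2 by simp
      then have "q (y r n) * q (v r n) \<le> e / (4 * (q 1 + 1)) * (2 * q 1)"
        using yr e q1 by (intro mult_mono seminorm_nonneg v_mem) auto
      also have "\<dots> \<le> e / 2" using e q1 by (simp add: field_simps)
      finally show ?thesis using 1 by simp
    qed
    \<comment> \<open>The bound is uniform in \<open>n\<close>: corresponding nodes on the two
      circles are \<open>R - r\<close> apart, however many there are. This is why \<open>d\<close>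
      could be fixed before \<open>n\<close>.\<close>
    have vRr: "q (v R n - v r n) \<le> e / 2"
    proof -
      define c where "c = (\<lambda>k. cis (2 * pi * real k / real n))"
      have lip: "q (w (of_real R * c k) - w (of_real r * c k)) \<le> e / 2" for k
      proof -
        have "q (w (of_real R * c k) - w (of_real r * c k))
            \<le> cmod (of_real R * c k - of_real r * c k) * q b * q (w (of_real R * c k)) * q (w (of_real r * c k))"
          by (rule resolvent_lipschitz[OF b w])
        also have "cmod (of_real R * c k - of_real r * c k) = R - r"
          using r0 by (simp add: c_def left_diff_distrib[symmetric] norm_mult of_real_diff[symmetric]
              del: of_real_diff)
        also have "(R - r) * q b * q (w (of_real R * c k)) * q (w (of_real r * c k)) \<le> d * (q b + 1) * K * K"
          using r r0 R0 qb K d by (intro mult_mono K(2) seminorm_nonneg w)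
            (auto simp: c_def norm_mult intro!: mult_nonneg_nonneg seminorm_nonneg w b)
        also have "\<dots> = d * s"
          by (simp add: s_def mult_ac)
        also have "\<dots> = e / 2"
          using s by (simp add: d_def)
        finally show ?thesis .
      qed
      have "v R n - v r n = fun_scale (1 / of_nat n)
          (\<Sum>k<n. w (of_real R * c k) - w (of_real r * c k))"
        by (simp add: v_def c_def fun_eq_iff fun_scale_def sum_fun_apply sum_subtractf right_diff_distrib)
      then have "q (v R n - v r n) = 1 / n * q (\<Sum>k<n. w (of_real R * c k) - w (of_real r * c k))"
        using n by (simp add: seminorm_scale closed_intros w norm_divide)
      also have "\<dots> \<le> 1 / n * (\<Sum>k<n. q (w (of_real R * c k) - w (of_real r * c k)))"
        by (intro mult_left_mono seminorm_sum closed_intros w) auto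
      also have "\<dots> \<le> 1 / n * (\<Sum>k<n. e / 2)"
        by (intro mult_left_mono sum_mono lip) auto
      also have "\<dots> = e / 2" using n by simp
      finally show ?thesis .
    qed
    have vR: "q (v R n - 1) \<le> e"
      using seminorm_triangle[of "v R n - v r n" "v r n - 1"] vr vRr
      by (simp add: closed_intros v_mem)
    \<comment> \<open>Modulo null elements \<open>(1 - y) * v = 1\<close>, which rearranges to
      \<open>y = (v - 1) * (1 - y)\<close>.\<close>
    have "q (y R n) = q ((v R n - 1) * (1 - y R n))"
    proof (rule seminorm_cong)
      have "y R n - (v R n - 1) * (1 - y R n) = - ((1 - y R n) * v R n - 1)"
        by (simp add: algebra_simps)
      moreover have "q (- ((1 - y R n) * v R n - 1)) = 0"
        using yv[OF n, of R] by (subst seminorm_uminus) (intro closed_intros y_mem v_mem | simp)+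
      ultimately show "q (y R n - (v R n - 1) * (1 - y R n)) = 0"
        by metis
    qed (intro closed_intros y_mem v_mem)+
    also have "\<dots> \<le> q (v R n - 1) * q (1 - y R n)"
      by (intro seminorm_mult closed_intros y_mem v_mem)
    also have "\<dots> \<le> e * (q 1 + q (y R n))"
      using vR e by (intro mult_mono seminorm_diff seminorm_nonneg closed_intros y_mem v_mem) auto
    also have "\<dots> \<le> 1/4 + 1/4 * q (y R n)"
      using e(3) mult_right_mono[OF e(2) seminorm_nonneg[OF y_mem, of R n]]
      by (simp add: distrib_left)
    finally have "q (y R n) < 1" by simp
    then show ?thesis using R0 n by (auto simp: G_def)
  qed
  ultimately show False by blast
qed

end

section \<open>Ideals of Banach function algebras\<close>

sublocale banach_function_algebra \<subseteq> seminormed_function_algebra A nrm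
  by unfold_locales (fact subspace mult_closed constants nrm_nonneg nrm_scale nrm_triangle nrm_mult)+

section \<open>Neumann series and exponentials\<close>

context banach_function_algebra
begin

lemma absolutely_summable_converges:
  assumes u: "\<And>n. u n \<in> A" and "summable (\<lambda>n. nrm (u n))"
  shows "\<exists>f\<in>A. (\<lambda>n. nrm ((\<Sum>i<n. u i) - f)) \<longlonglongrightarrow> 0"
proof (rule complete)
  fix e :: real assume "e > 0"
  then obtain N where N: "\<And>m n. m \<ge> N \<Longrightarrow> norm (\<Sum>i=m..<n. nrm (u i)) < e"
    using assms(2) unfolding summable_Cauchy by blast
  have le: "nrm ((\<Sum>i<m. u i) - (\<Sum>i<n. u i)) < e" if "N \<le> n" "n \<le> m" for m n
  proof -
    have "(\<Sum>i<m. u i) - (\<Sum>i<n. u i) = (\<Sum>i=n..<m. u i)"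
      using that(2) by (simp add: sum_diff_nat_ivl lessThan_atLeast0)
    moreover have "nrm (\<Sum>i=n..<m. u i) \<le> (\<Sum>i=n..<m. nrm (u i))"
      using u by (rule seminorm_sum)
    ultimately show ?thesis
      using N[OF that(1), of m] by simp
  qed
  show "\<exists>M. \<forall>m\<ge>M. \<forall>n\<ge>M. nrm ((\<Sum>i<m. u i) - (\<Sum>i<n. u i)) < e"
  proof (intro exI[of _ N] allI impI)
    fix m n assume "N \<le> m" "N \<le> n"
    then show "nrm ((\<Sum>i<m. u i) - (\<Sum>i<n. u i)) < e"
      using le[of n m] le[of m n] seminorm_commute[of "\<Sum>i<m. u i" "\<Sum>i<n. u i"] u
      by (cases "n \<le> m") (auto simp: sum_closed)
  qed
qed (intro closed_intros u)

lemma neumann_inverse: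
  assumes f: "f \<in> A" and "nrm f < 1"
  shows "\<exists>g\<in>A. (1 - f) * g = 1"
proof -
  have "summable (\<lambda>n. nrm (f ^ n))"
  proof (rule summable_comparison_test')
    show "summable (\<lambda>n. nrm f ^ n)"
      using assms nrm_nonneg by (intro summable_geometric) auto
    show "norm (nrm (f ^ n)) \<le> nrm f ^ n" if "n \<ge> 1" for n
      using that seminorm_power[OF f] nrm_nonneg[OF power_closed[OF f]] by simp
  qed
  then obtain g where g: "g \<in> A" and lim: "(\<lambda>n. nrm ((\<Sum>i<n. f ^ i) - g)) \<longlonglongrightarrow> 0"
    and lim0: "(\<lambda>n. nrm (f ^ n)) \<longlonglongrightarrow> 0"
    using absolutely_summable_converges[of "\<lambda>n. f ^ n"] power_closed[OF f] summable_LIMSEQ_zero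
    by blast
  have "nrm ((1 - f) * g - 1) \<le> nrm (1 - f) * nrm ((\<Sum>i<n. f ^ i) - g) + nrm (f ^ n)" for n
  proof -
    have s: "(\<Sum>i<n. f ^ i) \<in> A" by (intro closed_intros f)
    have "(1 - f) * (\<Sum>i<n. f ^ i) = 1 - f ^ n"
      by (simp add: fun_eq_iff sum_fun_apply power_fun_apply one_diff_power_eq)
    then have "(1 - f) * g - 1 = (1 - f) * (g - (\<Sum>i<n. f ^ i)) - f ^ n"
      by (simp add: algebra_simps)
    then have "nrm ((1 - f) * g - 1) = nrm ((1 - f) * (g - (\<Sum>i<n. f ^ i)) - f ^ n)"
      by (rule arg_cong)
    also have "\<dots> \<le> nrm ((1 - f) * (g - (\<Sum>i<n. f ^ i))) + nrm (f ^ n)"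
      by (intro seminorm_diff closed_intros f g)
    also have "nrm ((1 - f) * (g - (\<Sum>i<n. f ^ i))) \<le> nrm (1 - f) * nrm (g - (\<Sum>i<n. f ^ i))"
      by (intro nrm_mult closed_intros f g)
    also have "nrm (g - (\<Sum>i<n. f ^ i)) = nrm ((\<Sum>i<n. f ^ i) - g)"
      by (rule seminorm_commute[OF g s])
    finally show ?thesis by (simp only: add_right_mono)
  qed
  moreover have "(\<lambda>n. nrm (1 - f) * nrm ((\<Sum>i<n. f ^ i) - g) + nrm (f ^ n)) \<longlonglongrightarrow> nrm (1 - f) * 0 + 0"
    by (intro tendsto_intros lim lim0)
  ultimately have "nrm ((1 - f) * g - 1) \<le> 0"
    by (intro LIMSEQ_le_const[of _ "nrm (1 - f) * 0 + 0", simplified]) auto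
  moreover have "(1 - f) * g - 1 \<in> A" by (intro closed_intros f g)
  ultimately have "(1 - f) * g - 1 = 0"
    using nrm_nonneg nrm_eq_0_iff by (metis order.antisym)
  then show ?thesis using g by auto
qed

text \<open>Otherwise \<open>1 - f / f x\<close> would be invertible by the Neumann series although
  it vanishes at \<open>x\<close>. Convergence in \<open>nrm\<close> therefore implies pointwise
  convergence.\<close>

lemma cmod_le_nrm:
  assumes f: "f \<in> A"
  shows "cmod (f x) \<le> nrm f"
proof (rule ccontr)
  assume *: "\<not> cmod (f x) \<le> nrm f"
  then have "f x \<noteq> 0" using nrm_nonneg[OF f] by auto
  have "nrm (fun_scale (1 / f x) f) < 1"
    using * \<open>f x \<noteq> 0\<close> f by (simp add: nrm_scale norm_divide divide_less_eq)
  then obtain g where "(1 - fun_scale (1 / f x) f) * g = 1"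
    using neumann_inverse scale_closed[OF f] by blast
  then have "((1 - fun_scale (1 / f x) f) * g) x = 1" by simp
  then show False using \<open>f x \<noteq> 0\<close> by (simp add: fun_scale_def)
qed

text \<open>Completeness provides a limit of the exponential series in \<open>A\<close>, and
  pointwise convergence identifies it.\<close>

lemma exp_closed:
  assumes f: "f \<in> A"
  shows "(\<lambda>x. exp (f x)) \<in> A"
proof -
  define u where "u = (\<lambda>n. fun_scale (1 / fact n) (f ^ n))"
  have u: "u n \<in> A" for n unfolding u_def by (intro closed_intros f)
  have "summable (\<lambda>n. nrm (u n))"
  proof (rule summable_comparison_test')
    show "summable (\<lambda>n. inverse (fact n) * nrm f ^ n)"
      by (rule summable_exp)
    show "norm (nrm (u n)) \<le> inverse (fact n) * nrm f ^ n" if "n \<ge> 1" for n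
      using that seminorm_power[OF f, of n] nrm_nonneg[OF u, of n]
      by (simp add: u_def nrm_scale power_closed f norm_divide divide_simps)
  qed
  then obtain g where g: "g \<in> A" and lim: "(\<lambda>n. nrm ((\<Sum>i<n. u i) - g)) \<longlonglongrightarrow> 0"
    using absolutely_summable_converges[of u] u by blast
  have "g x = exp (f x)" for x
  proof (rule LIMSEQ_unique)
    have "(\<lambda>n. (\<Sum>i<n. u i) x - g x) \<longlonglongrightarrow> 0"
    proof (rule Lim_null_comparison[OF _ lim])
      show "eventually (\<lambda>n. norm ((\<Sum>i<n. u i) x - g x) \<le> nrm ((\<Sum>i<n. u i) - g)) sequentially"
        using cmod_le_nrm[of "(\<Sum>i<n. u i) - g" x for n] u g by (simp add: diff_closed sum_closed)
    qed
    then show "(\<lambda>n. (\<Sum>i<n. u i) x) \<longlonglongrightarrow> g x"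
      by (simp add: LIM_zero_iff)
    have "(\<lambda>n. \<Sum>i<n. f x ^ i /\<^sub>R fact i) \<longlonglongrightarrow> exp (f x)"
      using exp_converges[of "f x"] by (simp add: sums_def)
    then show "(\<lambda>n. (\<Sum>i<n. u i) x) \<longlonglongrightarrow> exp (f x)"
      by (simp add: u_def sum_fun_apply power_fun_apply fun_scale_def scaleR_conv_of_real
          divide_inverse mult.commute)
  qed
  then have "g = (\<lambda>x. exp (f x))" by blast
  then show ?thesis using g by simp
qed

end

section \<open>Quotient seminorms and maximal ideals\<close>

definition ideal_on :: "('a \<Rightarrow> complex) set \<Rightarrow> ('a \<Rightarrow> complex) set \<Rightarrow> bool"
  where "ideal_on A I \<longleftrightarrow> I \<subseteq> A \<and> cfun.subspace I \<and> (\<forall>f\<in>A. \<forall>g\<in>I. f * g \<in> I)"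

text \<open>The norm of the quotient by \<open>I\<close>, read on representatives. For an ideal
  \<open>I\<close> its null elements in \<open>A\<close> form the closure of
  \<open>I\<close>.\<close>

definition quotient_seminorm :: "(('a \<Rightarrow> complex) \<Rightarrow> real) \<Rightarrow> ('a \<Rightarrow> complex) set \<Rightarrow> ('a \<Rightarrow> complex) \<Rightarrow> real"
  where "quotient_seminorm nrm I f = (INF m\<in>I. nrm (f - m))"

context banach_function_algebra
begin

lemma quotient_seminorm_le:
  assumes "ideal_on A I" "f \<in> A" "m \<in> I"
  shows "quotient_seminorm nrm I f \<le> nrm (f - m)"
  unfolding quotient_seminorm_def using assms
  by (intro cINF_lower bdd_belowI[of _ 0]) (auto simp: ideal_on_def intro!: nrm_nonneg diff_closed)

text \<open>With the infimum written as a limit, each seminorm inequality follows from the one for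
  \<open>nrm\<close> by passing to the limit.\<close>

lemma quotient_seminorm_approx:
  assumes "ideal_on A I" "f \<in> A"
  shows "\<exists>m. (\<forall>n::nat. m n \<in> I) \<and> (\<lambda>n. nrm (f - m n)) \<longlonglongrightarrow> quotient_seminorm nrm I f"
proof -
  have ne: "I \<noteq> {}" using assms cfun.subspace_0 by (auto simp: ideal_on_def)
  have "\<exists>m\<in>I. nrm (f - m) < quotient_seminorm nrm I f + 1 / real (Suc n)" for n
  proof (rule ccontr)
    assume "\<not> ?thesis"
    then have "quotient_seminorm nrm I f + 1 / real (Suc n) \<le> quotient_seminorm nrm I f"
      unfolding quotient_seminorm_def[of nrm I f] using ne
      by (intro cINF_greatest) (auto simp: quotient_seminorm_def not_less)
    then show False by simp
  qed
  then obtain m where m: "\<And>n. m n \<in> I" "\<And>n. nrm (f - m n) < quotient_seminorm nrm I f + 1 / real (Suc n)"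
    by metis
  have "(\<lambda>n. nrm (f - m n)) \<longlonglongrightarrow> quotient_seminorm nrm I f"
  proof (rule tendsto_sandwich[where f = "\<lambda>_. quotient_seminorm nrm I f"])
    show "(\<lambda>n. quotient_seminorm nrm I f + 1 / real (Suc n)) \<longlonglongrightarrow> quotient_seminorm nrm I f"
      using tendsto_add[OF tendsto_const LIMSEQ_inverse_real_of_nat] by (simp add: inverse_eq_divide)
    show "eventually (\<lambda>n. nrm (f - m n) \<le> quotient_seminorm nrm I f + 1 / real (Suc n)) sequentially"
      using m(2) by (intro always_eventually allI less_imp_le)
    show "eventually (\<lambda>n. quotient_seminorm nrm I f \<le> nrm (f - m n)) sequentially"
      by (intro always_eventually allI quotient_seminorm_le[OF assms] m(1))
  qed simp
  with m(1) show ?thesis by blast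
qed

lemma seminormed_quotient:
  assumes I: "ideal_on A I"
  shows "seminormed_function_algebra A (quotient_seminorm nrm I)"
proof unfold_locales
  let ?q = "quotient_seminorm nrm I"
  have IA: "m \<in> A" if "m \<in> I" for m using that I by (auto simp: ideal_on_def)
  have Isub: "cfun.subspace I" and Imult: "\<And>f m. f \<in> A \<Longrightarrow> m \<in> I \<Longrightarrow> f * m \<in> I"
    using I by (auto simp: ideal_on_def)
  show "0 \<le> ?q f" if f: "f \<in> A" for f
  proof -
    obtain m where m: "\<And>n. m n \<in> I" "(\<lambda>n. nrm (f - m n)) \<longlonglongrightarrow> ?q f"
      using quotient_seminorm_approx[OF I f] by blast
    show ?thesis
      using m(1) IA f by (intro LIMSEQ_le_const[OF m(2)]) (auto intro!: nrm_nonneg diff_closed)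
  qed
  then have "?q 0 = 0"
    using quotient_seminorm_le[OF I zero_closed cfun.subspace_0[OF Isub]] zero_closed nrm_eq_0_iff[of 0]
    by (simp add: order.antisym)
  have scale_le: "?q (fun_scale c f) \<le> cmod c * ?q f" if f: "f \<in> A" for c f
  proof -
    obtain m where m: "\<And>n. m n \<in> I" "(\<lambda>n. nrm (f - m n)) \<longlonglongrightarrow> ?q f"
      using quotient_seminorm_approx[OF I f] by blast
    show ?thesis
    proof (rule LIMSEQ_le_const[OF tendsto_mult_left[OF m(2)]], intro exI allI impI)
      fix n
      have "?q (fun_scale c f) \<le> nrm (fun_scale c f - fun_scale c (m n))"
        by (intro quotient_seminorm_le[OF I] scale_closed f cfun.subspace_scale[OF Isub] m)
      also have "\<dots> = cmod c * nrm (f - m n)"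
        using f m(1) IA by (simp add: cfun.scale_right_diff_distrib[symmetric] nrm_scale diff_closed)
      finally show "?q (fun_scale c f) \<le> cmod c * nrm (f - m n)" .
    qed
  qed
  show "?q (fun_scale c f) = cmod c * ?q f" if f: "f \<in> A" for c f
  proof (cases "c = 0")
    case False
    have "?q f \<le> cmod (1 / c) * ?q (fun_scale c f)"
      using scale_le[OF scale_closed[OF f], of "1 / c" c] False by simp
    then have "cmod c * ?q f \<le> ?q (fun_scale c f)"
      using False by (simp add: norm_divide field_simps)
    with scale_le[OF f, of c] show ?thesis by simp
  qed (simp add: \<open>?q 0 = 0\<close>)
  show "?q (f + g) \<le> ?q f + ?q g" if fg: "f \<in> A" "g \<in> A" for f g
  proof -
    obtain m k where m: "\<And>n. m n \<in> I" "(\<lambda>n. nrm (f - m n)) \<longlonglongrightarrow> ?q f"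
      and k: "\<And>n. k n \<in> I" "(\<lambda>n. nrm (g - k n)) \<longlonglongrightarrow> ?q g"
      using quotient_seminorm_approx[OF I fg(1)] quotient_seminorm_approx[OF I fg(2)] by metis
    show ?thesis
    proof (rule LIMSEQ_le_const[OF tendsto_add[OF m(2) k(2)]], intro exI allI impI)
      fix n
      have "?q (f + g) \<le> nrm (f + g - (m n + k n))"
        by (intro quotient_seminorm_le[OF I] add_closed fg cfun.subspace_add[OF Isub] m k)
      also have "\<dots> = nrm ((f - m n) + (g - k n))"
        by (simp add: algebra_simps)
      also have "\<dots> \<le> nrm (f - m n) + nrm (g - k n)"
        by (intro nrm_triangle closed_intros fg IA m k)
      finally show "?q (f + g) \<le> nrm (f - m n) + nrm (g - k n)" .
    qed
  qed
  show "?q (f * g) \<le> ?q f * ?q g" if fg: "f \<in> A" "g \<in> A" for f g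
  proof -
    obtain m k where m: "\<And>n. m n \<in> I" "(\<lambda>n. nrm (f - m n)) \<longlonglongrightarrow> ?q f"
      and k: "\<And>n. k n \<in> I" "(\<lambda>n. nrm (g - k n)) \<longlonglongrightarrow> ?q g"
      using quotient_seminorm_approx[OF I fg(1)] quotient_seminorm_approx[OF I fg(2)] by metis
    show ?thesis
    proof (rule LIMSEQ_le_const[OF tendsto_mult[OF m(2) k(2)]], intro exI allI impI)
      fix n
      \<comment> \<open>The element of \<open>I\<close> is chosen so that the difference factors as
        \<open>(f - m n) * (g - k n)\<close>.\<close>
      have "?q (f * g) \<le> nrm (f * g - ((f - m n) * k n + g * m n))"
        by (intro quotient_seminorm_le[OF I] mult_closed fg cfun.subspace_add[OF Isub] Imult
            diff_closed IA m k)
      also have "\<dots> = nrm ((f - m n) * (g - k n))"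
        by (simp add: algebra_simps)
      also have "\<dots> \<le> nrm (f - m n) * nrm (g - k n)"
        by (intro nrm_mult closed_intros fg IA m k)
      finally show "?q (f * g) \<le> nrm (f - m n) * nrm (g - k n)" .
    qed
  qed
qed (fact subspace mult_closed constants)+

text \<open>An \<open>m\<close> closer to 1 would be invertible by the Neumann series. Hence the
  closure of a proper ideal is still proper.\<close>

lemma nrm_one_minus_ideal:
  assumes I: "ideal_on A I" "1 \<notin> I" and m: "m \<in> I"
  shows "nrm (1 - m) \<ge> 1"
proof (rule ccontr)
  assume "\<not> nrm (1 - m) \<ge> 1"
  moreover have "1 - m \<in> A"
    using I m by (auto simp: ideal_on_def intro!: closed_intros)
  ultimately obtain g where g: "g \<in> A" "(1 - (1 - m)) * g = 1"
    using neumann_inverse[of "1 - m"] by auto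
  then have "g * m = 1" by (simp add: mult.commute)
  then show False using I m g by (metis ideal_on_def)
qed

text \<open>The ideal generated by \<open>I\<close> and \<open>f\<close>: for maximal
  \<open>I\<close> it serves to invert \<open>f\<close> modulo \<open>I\<close>, for
  \<open>{0}\<close> it is the principal ideal of \<open>f\<close>.\<close>

lemma ideal_on_principal_extension:
  assumes I: "ideal_on A I" and f: "f \<in> A"
  shows "ideal_on A {m + f * g | m g. m \<in> I \<and> g \<in> A}"
  unfolding ideal_on_def
proof (intro conjI ballI)
  have Isub: "cfun.subspace I" and Imult: "\<And>f m. f \<in> A \<Longrightarrow> m \<in> I \<Longrightarrow> f * m \<in> I"
    and IA: "I \<subseteq> A"
    using I by (auto simp: ideal_on_def)
  show "{m + f * g | m g. m \<in> I \<and> g \<in> A} \<subseteq> A"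
    using IA f by (auto intro!: closed_intros)
  show "cfun.subspace {m + f * g | m g. m \<in> I \<and> g \<in> A}"
  proof (rule cfun.subspaceI)
    have "0 = 0 + f * 0" by simp
    then show "0 \<in> {m + f * g | m g. m \<in> I \<and> g \<in> A}"
      using cfun.subspace_0[OF Isub] zero_closed by blast
  next
    fix h k assume "h \<in> {m + f * g | m g. m \<in> I \<and> g \<in> A}" "k \<in> {m + f * g | m g. m \<in> I \<and> g \<in> A}"
    then obtain m g m' g' where "h = m + f * g" "k = m' + f * g'" "m \<in> I" "m' \<in> I" "g \<in> A" "g' \<in> A"
      by blast
    moreover from this have "h + k = (m + m') + f * (g + g')"
      by (simp add: algebra_simps)
    ultimately show "h + k \<in> {m + f * g | m g. m \<in> I \<and> g \<in> A}"
      using cfun.subspace_add[OF Isub] add_closed by blast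
  next
    fix c h assume "h \<in> {m + f * g | m g. m \<in> I \<and> g \<in> A}"
    then obtain m g where "h = m + f * g" "m \<in> I" "g \<in> A" by blast
    moreover from this have "fun_scale c h = fun_scale c m + f * fun_scale c g"
      by (simp add: fun_scale_def fun_eq_iff algebra_simps)
    ultimately show "fun_scale c h \<in> {m + f * g | m g. m \<in> I \<and> g \<in> A}"
      using cfun.subspace_scale[OF Isub] scale_closed by blast
  qed
  fix h k assume "h \<in> A" "k \<in> {m + f * g | m g. m \<in> I \<and> g \<in> A}"
  moreover from this obtain m g where "k = m + f * g" "m \<in> I" "g \<in> A" by blast
  moreover from this have "h * k = h * m + f * (h * g)"
    by (simp add: algebra_simps)
  ultimately show "h * k \<in> {m + f * g | m g. m \<in> I \<and> g \<in> A}"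
    using Imult mult_closed by blast
qed

lemma ex_maximal_ideal:
  assumes I: "ideal_on A I" "1 \<notin> I"
  shows "\<exists>M. ideal_on A M \<and> I \<subseteq> M \<and> 1 \<notin> M \<and> (\<forall>J. ideal_on A J \<longrightarrow> M \<subseteq> J \<longrightarrow> 1 \<notin> J \<longrightarrow> J = M)"
proof -
  define F where "F = {J. ideal_on A J \<and> I \<subseteq> J \<and> 1 \<notin> J}"
  have "\<exists>M\<in>F. \<forall>X\<in>F. M \<subseteq> X \<longrightarrow> X = M"
  proof (rule subset_Zorn_nonempty)
    show "F \<noteq> {}" using I by (auto simp: F_def)
    fix C assume C: "C \<noteq> {}" "subset.chain F C"
    then have CF: "\<And>J. J \<in> C \<Longrightarrow> ideal_on A J \<and> I \<subseteq> J \<and> 1 \<notin> J"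
      by (auto simp: F_def subset_chain_def)
    have "cfun.subspace (\<Union>C)"
    proof (rule cfun.subspaceI)
      show "0 \<in> \<Union>C" using C(1) CF cfun.subspace_0 unfolding ideal_on_def by blast
      show "fun_scale c f \<in> \<Union>C" if "f \<in> \<Union>C" for c f
        using that CF cfun.subspace_scale unfolding ideal_on_def by blast
      fix f g assume "f \<in> \<Union>C" "g \<in> \<Union>C"
      then obtain J where "J \<in> C" "f \<in> J" "g \<in> J"
        using C(2) unfolding subset_chain_def by blast
      then show "f + g \<in> \<Union>C"
        using CF cfun.subspace_add unfolding ideal_on_def by blast
    qed
    then show "\<Union>C \<in> F"
      using C(1) CF by (fastforce simp: F_def ideal_on_def)
  qed
  then show ?thesis unfolding F_def by (metis (mono_tags, lifting) mem_Collect_eq subset_trans)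
qed

end

section \<open>From maximal ideals to points of the space\<close>

context natural_banach_function_algebra
begin

lemma proper_ideal_common_zero:
  assumes "ideal_on A I" "1 \<notin> I"
  shows "\<exists>x. \<forall>f\<in>I. f x = 0"
proof -
  obtain M where M: "ideal_on A M" "I \<subseteq> M" "1 \<notin> M"
    and max: "\<And>J. ideal_on A J \<Longrightarrow> M \<subseteq> J \<Longrightarrow> 1 \<notin> J \<Longrightarrow> J = M"
    using ex_maximal_ideal[OF assms] by blast
  have Msub: "cfun.subspace M" and Mmult: "\<And>f m. f \<in> A \<Longrightarrow> m \<in> M \<Longrightarrow> f * m \<in> M"
    and MA: "M \<subseteq> A"
    using M by (auto simp: ideal_on_def)
  define q where "q = quotient_seminorm nrm M"
  interpret q: seminormed_function_algebra A q
    unfolding q_def by (rule seminormed_quotient[OF M(1)])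
  have q_zero: "q m = 0" if "m \<in> M" for m
    using quotient_seminorm_le[OF M(1), of m m] that MA q.seminorm_nonneg[of m]
      nrm_eq_0_iff[of 0] zero_closed by (auto simp: q_def)
  have q1: "q 1 \<ge> 1"
    unfolding q_def quotient_seminorm_def
    using cfun.subspace_0[OF Msub] nrm_one_minus_ideal[OF M(1,3)] by (intro cINF_greatest) auto
  \<comment> \<open>Maximal ideals are closed: the null elements form an ideal that contains
    \<open>M\<close> and misses 1.\<close>
  have "{f \<in> A. q f = 0} = M"
  proof (rule max)
    show "ideal_on A {f \<in> A. q f = 0}"
      unfolding ideal_on_def
      by (auto intro!: cfun.subspaceI q.seminorm_zero closed_intros q.seminorm_mult_null
          q.seminorm_add_null simp: q.seminorm_scale)
  qed (use q1 q_zero MA in auto)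
  then have q_iff: "q f = 0 \<longleftrightarrow> f \<in> M" if "f \<in> A" for f
    using that by blast
  have "\<exists>g\<in>A. q (f * g - 1) = 0" if f: "f \<in> A" "q f \<noteq> 0" for f
  proof -
    \<comment> \<open>As \<open>f\<close> is not in \<open>M\<close>, maximality puts 1 into
      \<open>J\<close>, and \<open>1 = m + f * g\<close> inverts \<open>f\<close> modulo
      \<open>M\<close>.\<close>
    define J where "J = {m + f * g | m g. m \<in> M \<and> g \<in> A}"
    have J: "ideal_on A J" unfolding J_def by (rule ideal_on_principal_extension[OF M(1) f(1)])
    have "m + f * 0 \<in> J" if "m \<in> M" for m
      unfolding J_def using that zero_closed by blast
    then have "M \<subseteq> J" by auto
    moreover have "0 + f * 1 \<in> J"
      unfolding J_def using cfun.subspace_0[OF Msub] one_closed by blast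
    ultimately have "1 \<in> J"
      using max[OF J] f q_zero by auto
    then obtain m g where mg: "1 = m + f * g" "m \<in> M" "g \<in> A" by (auto simp: J_def)
    then have "f * g - 1 = - m" by (simp add: algebra_simps)
    moreover have "q (- m) = 0"
      using mg MA q_zero[of m] q.seminorm_uminus[of m] by auto
    ultimately have "q (f * g - 1) = 0" by metis
    then show ?thesis using mg by blast
  qed
  then have "\<exists>c. q (a - fun_scale c 1) = 0" if "a \<in> A" for a
    using q.gelfand_mazur[OF _ _ that] q1 by auto
  then have "\<exists>c. a - fun_scale c 1 \<in> M" if "a \<in> A" for a
    using that q_iff by (meson closed_intros)
  then obtain \<psi> where \<psi>: "\<And>a. a \<in> A \<Longrightarrow> a - fun_scale (\<psi> a) 1 \<in> M"
    by metis
  \<comment> \<open>Two different scalars would put a nonzero constant into \<open>M\<close>. Each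
    law of a character then reduces to exhibiting one element of \<open>M\<close>.\<close>
  have uniq: "\<psi> a = c" if "a \<in> A" "a - fun_scale c 1 \<in> M" for a c
  proof (rule ccontr)
    assume "\<psi> a \<noteq> c"
    have "(a - fun_scale (\<psi> a) 1) - (a - fun_scale c 1) \<in> M"
      using that \<psi> cfun.subspace_diff[OF Msub] by blast
    then have "fun_scale (1 / (c - \<psi> a)) ((a - fun_scale (\<psi> a) 1) - (a - fun_scale c 1)) \<in> M"
      using cfun.subspace_scale[OF Msub] by blast
    also have "fun_scale (1 / (c - \<psi> a)) ((a - fun_scale (\<psi> a) 1) - (a - fun_scale c 1)) = 1"
      using \<open>\<psi> a \<noteq> c\<close> by (auto simp: fun_eq_iff fun_scale_def field_simps)
    finally show False using M(3) by contradiction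
  qed
  have "character_on A \<psi>"
    unfolding character_on_def multiplicative_on_def
  proof (intro conjI ballI allI)
    fix f g assume fg: "f \<in> A" "g \<in> A"
    show "\<psi> (f + g) = \<psi> f + \<psi> g"
    proof (rule uniq)
      have "(f - fun_scale (\<psi> f) 1) + (g - fun_scale (\<psi> g) 1) \<in> M"
        using fg \<psi> cfun.subspace_add[OF Msub] by blast
      also have "(f - fun_scale (\<psi> f) 1) + (g - fun_scale (\<psi> g) 1) = f + g - fun_scale (\<psi> f + \<psi> g) 1"
        by (simp add: fun_eq_iff fun_scale_def)
      finally show "f + g - fun_scale (\<psi> f + \<psi> g) 1 \<in> M" .
    qed (intro closed_intros fg)
    show "\<psi> (f * g) = \<psi> f * \<psi> g"
    proof (rule uniq)
      have "g * (f - fun_scale (\<psi> f) 1) + fun_scale (\<psi> f) (g - fun_scale (\<psi> g) 1) \<in> M"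
        using fg \<psi> by (intro cfun.subspace_add[OF Msub] cfun.subspace_scale[OF Msub] Mmult)
      also have "g * (f - fun_scale (\<psi> f) 1) + fun_scale (\<psi> f) (g - fun_scale (\<psi> g) 1) = f * g - fun_scale (\<psi> f * \<psi> g) 1"
        by (simp add: fun_eq_iff fun_scale_def algebra_simps)
      finally show "f * g - fun_scale (\<psi> f * \<psi> g) 1 \<in> M" .
    qed (intro closed_intros fg)
  next
    fix c f assume f: "f \<in> A"
    show "\<psi> (fun_scale c f) = c * \<psi> f"
    proof (rule uniq)
      have "fun_scale c (f - fun_scale (\<psi> f) 1) \<in> M"
        using f \<psi> cfun.subspace_scale[OF Msub] by blast
      also have "fun_scale c (f - fun_scale (\<psi> f) 1) = fun_scale c f - fun_scale (c * \<psi> f) 1"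
        by (simp add: fun_eq_iff fun_scale_def algebra_simps)
      finally show "fun_scale c f - fun_scale (c * \<psi> f) 1 \<in> M" .
    qed (intro closed_intros f)
  next
    have "\<psi> 1 = 1" using cfun.subspace_0[OF Msub] by (intro uniq one_closed) simp
    then show "\<exists>f\<in>A. \<psi> f \<noteq> 0" using one_closed by force
  qed
  then obtain x where x: "\<And>f. f \<in> A \<Longrightarrow> \<psi> f = f x" using natural by blast
  have "f x = 0" if "f \<in> I" for f
    using that M(2) MA x[of f] uniq[of f 0] by auto
  then show ?thesis by blast
qed

text \<open>If \<open>f\<close> were not invertible, its principal ideal would be proper, and a
  common zero of that ideal is a zero of \<open>f\<close>.\<close>

lemma nonvanishing_invertible:
  assumes f: "f \<in> A" and nz: "\<And>x. f x \<noteq> 0"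
  shows "f \<in> invertibles A"
proof (rule ccontr)
  assume *: "f \<notin> invertibles A"
  have "ideal_on A {0}"
    by (auto simp: ideal_on_def zero_closed)
  then have J: "ideal_on A {m + f * g | m g. m \<in> {0} \<and> g \<in> A}"
    using f by (rule ideal_on_principal_extension)
  moreover have "1 \<notin> {m + f * g | m g. m \<in> {0} \<and> g \<in> A}"
    using * f by (auto simp: invertibles_def)
  ultimately obtain x where x: "\<And>h. h \<in> {m + f * g | m g. m \<in> {0} \<and> g \<in> A} \<Longrightarrow> h x = 0"
    using proper_ideal_common_zero by blast
  have "0 + f * 1 \<in> {m + f * g | m g. m \<in> {0} \<and> g \<in> A}"
    using one_closed by blast
  then show False using x[of "0 + f * 1"] nz by auto
qed

lemma spectrum_subset_range:
  assumes f: "f \<in> A"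
  shows "spectrum A f \<subseteq> range f"
proof
  fix c assume "c \<in> spectrum A f"
  then have "\<exists>x. (f - fun_scale c 1) x = 0"
    using nonvanishing_invertible[of "f - fun_scale c 1"] f closed_intros
    by (auto simp: spectrum_def)
  then show "c \<in> range f" by (auto simp: fun_scale_def)
qed

end

section \<open>Multiplicative spectral functionals\<close>

locale regular_spectral_functional = natural_banach_function_algebra A nrm
  for A :: "('a::t2_space \<Rightarrow> complex) set" and nrm +
  fixes \<phi> :: "('a \<Rightarrow> complex) \<Rightarrow> complex"
  assumes urysohn: "closed F \<Longrightarrow> closed K \<Longrightarrow> F \<inter> K = {} \<Longrightarrow>
      \<exists>h\<in>A. range h \<subseteq> complex_of_real ` {0..1} \<and> (\<forall>x\<in>F. h x = 0) \<and> (\<forall>x\<in>K. h x = 1)"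
    and multiplicative: "multiplicative_on A \<phi>"
    and spectral: "spectral_on A \<phi>"
begin

section \<open>Real-valued elements and cutting off near a point\<close>

definition real_elements :: "('a \<Rightarrow> real) set"
  where "real_elements = {g. (\<lambda>x. complex_of_real (g x)) \<in> A}"

lemma real_memD: "g \<in> real_elements \<Longrightarrow> (\<lambda>x. complex_of_real (g x)) \<in> A"
  by (simp add: real_elements_def)

lemma real_add: "g \<in> real_elements \<Longrightarrow> k \<in> real_elements \<Longrightarrow> (\<lambda>x. g x + k x) \<in> real_elements"
  using add_closed[of "\<lambda>x. of_real (g x)" "\<lambda>x. of_real (k x)"]
  by (simp add: real_elements_def plus_fun_def)

lemma real_mult: "g \<in> real_elements \<Longrightarrow> k \<in> real_elements \<Longrightarrow> (\<lambda>x. g x * k x) \<in> real_elements"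
  using mult_closed[of "\<lambda>x. of_real (g x)" "\<lambda>x. of_real (k x)"]
  by (simp add: real_elements_def times_fun_def)

lemma real_const: "(\<lambda>_. c) \<in> real_elements"
  using constants by (simp add: real_elements_def)

lemma real_square_dist:
  assumes "g \<in> real_elements"
  shows "(\<lambda>x. (g x - c)\<^sup>2) \<in> real_elements"
  using real_mult[OF real_add[OF assms real_const] real_add[OF assms real_const], of "- c" "- c"]
  by (simp add: power2_eq_square)

lemma real_continuous: "g \<in> real_elements \<Longrightarrow> continuous_on UNIV g"
  using continuous_on_Re[OF continuous[OF real_memD]] by simp

lemma real_abs_le: "g \<in> real_elements \<Longrightarrow> \<bar>g x\<bar> \<le> nrm (\<lambda>x. complex_of_real (g x))"
  using cmod_le_nrm[OF real_memD, of g x] by simp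

lemma real_urysohn:
  assumes "closed F" "closed K" "F \<inter> K = {}"
  obtains k where "k \<in> real_elements" "\<And>x. 0 \<le> k x" "\<And>x. k x \<le> 1"
    "\<And>x. x \<in> F \<Longrightarrow> k x = 0" "\<And>x. x \<in> K \<Longrightarrow> k x = 1"
proof -
  obtain h where h: "h \<in> A" "range h \<subseteq> complex_of_real ` {0..1}"
    "\<And>x. x \<in> F \<Longrightarrow> h x = 0" "\<And>x. x \<in> K \<Longrightarrow> h x = 1"
    using urysohn[OF assms] by blast
  have "h x \<in> complex_of_real ` {0..1}" for x
    using h(2) by blast
  then have h_eq: "h x = complex_of_real (Re (h x))" "0 \<le> Re (h x)" "Re (h x) \<le> 1" for x
    by (metis imageE Re_complex_of_real atLeastAtMost_iff)+
  then have "h = (\<lambda>x. complex_of_real (Re (h x)))" by blast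
  then have "(\<lambda>x. Re (h x)) \<in> real_elements"
    using h(1) by (simp add: real_elements_def)
  then show ?thesis
    using that[of "\<lambda>x. Re (h x)"] h h_eq by simp
qed

text \<open>The form in which the spectral hypothesis is used from here on; the point depends on
  \<open>f\<close>.\<close>

lemma value_in_range: "f \<in> A \<Longrightarrow> \<exists>x. \<phi> f = f x"
  using spectral spectrum_subset_range by (fastforce simp: spectral_on_def)

lemma phi_mult: "f \<in> A \<Longrightarrow> g \<in> A \<Longrightarrow> \<phi> (\<lambda>x. f x * g x) = \<phi> f * \<phi> g"
  using multiplicative by (simp add: multiplicative_on_def times_fun_def)

text \<open>
  If \<open>\<phi> k \<noteq> 0\<close> and \<open>f k = g k\<close> then \<open>\<phi> f = \<phi> g\<close>, so \<open>\<phi> f\<close> depends only on the germ of \<open>f\<close>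
  at \<open>x\<^sub>0\<close>. It therefore lies in the range of any function with the same germ as \<open>f\<close>, and this
  range can be taken arbitrarily close to \<open>f x\<^sub>0\<close>.
\<close>

lemma evaluation_if_nonzero_on_peaks:
  assumes nz: "\<And>k. k \<in> real_elements \<Longrightarrow> (\<And>x. 0 \<le> k x) \<Longrightarrow> k x\<^sub>0 = 1 \<Longrightarrow>
      \<phi> (\<lambda>x. complex_of_real (k x)) \<noteq> 0"
    and f: "f \<in> A"
  shows "\<phi> f = f x\<^sub>0"
proof -
  have "cmod (\<phi> f - f x\<^sub>0) \<le> e" if e: "e > 0" for e
  proof -
    have cont: "continuous_on UNIV (\<lambda>x. cmod (f x - f x\<^sub>0))"
      by (intro continuous_intros continuous f)
    then have closed: "closed {x. e \<le> cmod (f x - f x\<^sub>0)}" "closed {x. cmod (f x - f x\<^sub>0) \<le> e / 2}"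
      "closed {x. e / 2 \<le> cmod (f x - f x\<^sub>0)}"
      by (intro closed_Collect_le continuous_on_const; assumption)+
    \<comment> \<open>Two nested cutoffs: \<open>h\<close> flattens \<open>f\<close> to the constant
      \<open>f x\<^sub>0\<close> away from that value, and \<open>k\<close> vanishes wherever
      \<open>h\<close> might differ from 1, so that \<open>f * k = g * k\<close>.\<close>
    obtain h where h: "h \<in> real_elements" "\<And>x. 0 \<le> h x" "\<And>x. h x \<le> 1"
      "\<And>x. cmod (f x - f x\<^sub>0) \<ge> e \<Longrightarrow> h x = 0" "\<And>x. cmod (f x - f x\<^sub>0) \<le> e / 2 \<Longrightarrow> h x = 1"
      by (rule real_urysohn[OF closed(1,2)]) (use e in auto)
    obtain k where k: "k \<in> real_elements" "\<And>x. 0 \<le> k x" "\<And>x. k x \<le> 1"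
      "\<And>x. cmod (f x - f x\<^sub>0) \<ge> e / 2 \<Longrightarrow> k x = 0" "\<And>x. x \<in> {x\<^sub>0} \<Longrightarrow> k x = 1"
      by (rule real_urysohn[OF closed(3), of "{x\<^sub>0}"]) (use e in auto)
    define g where "g = (\<lambda>x. f x\<^sub>0 + (f x - f x\<^sub>0) * complex_of_real (h x))"
    have "g = (\<lambda>_. f x\<^sub>0) + (f - (\<lambda>_. f x\<^sub>0)) * (\<lambda>x. complex_of_real (h x))"
      by (simp add: g_def fun_eq_iff)
    then have g: "g \<in> A"
      using f h(1) by (simp only: add_closed mult_closed diff_closed constants real_memD)
    have "(\<lambda>x. f x * complex_of_real (k x)) = (\<lambda>x. g x * complex_of_real (k x))"
    proof
      fix x show "f x * complex_of_real (k x) = g x * complex_of_real (k x)"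
        using h(5)[of x] k(4)[of x] by (cases "cmod (f x - f x\<^sub>0) \<le> e / 2") (auto simp: g_def)
    qed
    then have "\<phi> f * \<phi> (\<lambda>x. complex_of_real (k x)) = \<phi> g * \<phi> (\<lambda>x. complex_of_real (k x))"
      using phi_mult[OF f real_memD[OF k(1)]] phi_mult[OF g real_memD[OF k(1)]] by metis
    then have "\<phi> f = \<phi> g"
      using nz[of k] k by simp
    moreover obtain x where "\<phi> g = g x"
      using value_in_range[OF g] by blast
    moreover have "cmod (g x - f x\<^sub>0) \<le> e"
    proof (cases "cmod (f x - f x\<^sub>0) \<ge> e")
      case False
      have "cmod (f x - f x\<^sub>0) * h x \<le> e * 1"
        using False h(2,3) e by (intro mult_mono) auto
      then show ?thesis using h(2)[of x] by (simp add: g_def norm_mult)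
    qed (use h(4)[of x] e in \<open>simp add: g_def\<close>)
    ultimately show ?thesis by simp
  qed
  then have "cmod (\<phi> f - f x\<^sub>0) \<le> 0"
    by (rule field_le_epsilon) simp
  then show ?thesis by simp
qed

section \<open>The ideal spanned by the kernel\<close>

lemma ideal_on_span_kernel: "ideal_on A (cfun.span (kernel_on A \<phi>))"
  unfolding ideal_on_def
proof (intro conjI ballI)
  show "cfun.span (kernel_on A \<phi>) \<subseteq> A"
    using subspace by (intro cfun.span_minimal) (auto simp: kernel_on_def)
  show "cfun.subspace (cfun.span (kernel_on A \<phi>))"
    by (rule cfun.subspace_span)
  fix f g assume f: "f \<in> A" and g: "g \<in> cfun.span (kernel_on A \<phi>)"
  \<comment> \<open>The kernel need not be closed under sums, but multiplicativity makes it absorb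
    \<open>f\<close>, and the right-hand side is a subspace.\<close>
  have "cfun.span (kernel_on A \<phi>) \<subseteq> {g. f * g \<in> cfun.span (kernel_on A \<phi>)}"
  proof (rule cfun.span_minimal)
    show "kernel_on A \<phi> \<subseteq> {g. f * g \<in> cfun.span (kernel_on A \<phi>)}"
      using f multiplicative
      by (auto simp: kernel_on_def multiplicative_on_def mult_closed intro!: cfun.span_base)
    show "cfun.subspace {g. f * g \<in> cfun.span (kernel_on A \<phi>)}"
    proof (rule cfun.subspaceI)
      fix c g assume g: "g \<in> {g. f * g \<in> cfun.span (kernel_on A \<phi>)}"
      have "f * fun_scale c g = fun_scale c (f * g)"
        by (simp add: fun_scale_def fun_eq_iff)
      then show "fun_scale c g \<in> {g. f * g \<in> cfun.span (kernel_on A \<phi>)}"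
        using g cfun.span_scale by auto
    qed (auto simp: cfun.span_zero distrib_left intro: cfun.span_add)
  qed
  with g show "f * g \<in> cfun.span (kernel_on A \<phi>)" by blast
qed

text \<open>A function equal to 1 at the common zero cannot lie in the kernel, so
  \<open>\<phi>\<close> does not vanish on the peaks there.\<close>

lemma evaluation_if_one_notin_span_kernel:
  assumes "1 \<notin> cfun.span (kernel_on A \<phi>)"
  shows "\<exists>x\<^sub>0. \<forall>f\<in>A. \<phi> f = f x\<^sub>0"
proof -
  obtain x\<^sub>0 where x0: "\<And>f. f \<in> cfun.span (kernel_on A \<phi>) \<Longrightarrow> f x\<^sub>0 = 0"
    using proper_ideal_common_zero[OF ideal_on_span_kernel assms] by blast
  have "\<phi> (\<lambda>x. complex_of_real (k x)) \<noteq> 0" if "k \<in> real_elements" "k x\<^sub>0 = 1" for k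
    using x0[of "\<lambda>x. complex_of_real (k x)"] that
    by (auto simp: kernel_on_def real_memD cfun.span_base)
  then show ?thesis using evaluation_if_nonzero_on_peaks by blast
qed

section \<open>The logarithm of the functional on real exponentials\<close>

definition log_phi :: "('a \<Rightarrow> real) \<Rightarrow> real"
  where "log_phi g = ln (Re (\<phi> (\<lambda>x. exp (complex_of_real (g x)))))"

text \<open>\<open>\<phi>\<close> takes here a value of a positive function, so \<open>Re\<close>
  discards nothing and \<open>ln\<close> is applied to a positive number.\<close>

lemma phi_exp:
  assumes "g \<in> real_elements"
  shows "\<phi> (\<lambda>x. exp (complex_of_real (g x))) = complex_of_real (exp (log_phi g))"
proof -
  obtain x where "\<phi> (\<lambda>x. exp (complex_of_real (g x))) = exp (complex_of_real (g x))"
    using value_in_range[OF exp_closed[OF real_memD[OF assms]]] by blast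
  then show ?thesis by (simp add: log_phi_def exp_of_real)
qed

lemma log_phi_add:
  assumes "g \<in> real_elements" "k \<in> real_elements"
  shows "log_phi (\<lambda>x. g x + k x) = log_phi g + log_phi k"
proof -
  have "complex_of_real (exp (log_phi (\<lambda>x. g x + k x))) = complex_of_real (exp (log_phi g) * exp (log_phi k))"
    using phi_mult[OF exp_closed[OF real_memD[OF assms(1)]] exp_closed[OF real_memD[OF assms(2)]]]
      phi_exp[OF real_add[OF assms]]
    by (simp add: phi_exp assms exp_add)
  then have "exp (log_phi (\<lambda>x. g x + k x)) = exp (log_phi g + log_phi k)"
    by (simp only: of_real_eq_iff exp_add)
  then show ?thesis by simp
qed

text \<open>
  The modulus and the argument of \<open>exp (g + \<i> k / s)\<close> determine \<open>g\<close> and \<open>k\<close> separately once \<open>s\<close>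
  is large, so a single value of this function controls both.
\<close>

lemma log_phi_joint_value:
  assumes g: "g \<in> real_elements" and k: "k \<in> real_elements"
  shows "\<exists>x. log_phi g = g x \<and> log_phi k = k x"
proof -
  \<comment> \<open>Puts every \<open>k x / s\<close> into \<open>[-1, 1]\<close>, an interval
    shorter than \<open>2 * pi\<close>, so that \<open>U x\<close> determines \<open>k x\<close>.
    The summand 1 keeps \<open>s\<close> positive when \<open>k\<close> is zero.\<close>
  define s where "s = nrm (\<lambda>x. complex_of_real (k x)) + 1"
  have s: "s > 0" "\<bar>k x\<bar> \<le> s" for x
    using real_abs_le[OF k, of x] by (simp_all add: s_def)
  define U where "U = (\<lambda>x. exp (\<i> * complex_of_real (k x / s)))"
  have U: "U \<in> A"
    unfolding U_def using scale_closed[OF real_memD[OF k], of "\<i> / of_real s"]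
    by (intro exp_closed) (simp add: fun_scale_def)
  have norm_U: "cmod (U x) = 1" for x
    by (simp add: U_def)
  have *: "\<exists>x. log_phi h = h x \<and> \<phi> U = U x" if h: "h \<in> real_elements" for h
  proof -
    have "(\<lambda>x. exp (complex_of_real (h x)) * U x) \<in> A"
      using mult_closed[OF exp_closed[OF real_memD[OF h]] U] by (simp add: times_fun_def)
    then obtain x where "\<phi> (\<lambda>x. exp (complex_of_real (h x)) * U x) = exp (complex_of_real (h x)) * U x"
      using value_in_range by blast
    moreover have "\<phi> (\<lambda>x. exp (complex_of_real (h x)) * U x) = complex_of_real (exp (log_phi h)) * \<phi> U"
      using phi_mult[OF exp_closed[OF real_memD[OF h]] U] by (simp only: phi_exp[OF h])
    ultimately have eq: "complex_of_real (exp (log_phi h)) * \<phi> U = complex_of_real (exp (h x)) * U x"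
      by (simp only: exp_of_real)
    have "cmod (\<phi> U) = 1"
      using value_in_range[OF U] norm_U by auto
    then have "exp (log_phi h) = exp (h x)"
      using arg_cong[OF eq, of cmod] by (simp add: norm_mult norm_U)
    then show ?thesis using eq by auto
  qed
  \<comment> \<open>\<open>\<phi> U\<close> is the same number for \<open>g\<close> and for
    \<open>k\<close>, which ties the two points together: \<open>U x = U y\<close> forces
    \<open>k x = k y\<close>.\<close>
  obtain x y where x: "log_phi g = g x" "\<phi> U = U x" and y: "log_phi k = k y" "\<phi> U = U y"
    using *[OF g] *[OF k] by blast
  have "\<bar>k x / s\<bar> \<le> 1" "\<bar>k y / s\<bar> \<le> 1"
    using s by (simp_all add: abs_divide)
  then have "\<bar>k x / s - k y / s\<bar> < 2 * pi"
    using pi_gt3 by linarith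
  moreover have "U x = U y" using x(2) y(2) by simp
  ultimately have "\<i> * complex_of_real (k x / s) = \<i> * complex_of_real (k y / s)"
    unfolding U_def using exp_complex_eqI[of "\<i> * complex_of_real (k x / s)" "\<i> * complex_of_real (k y / s)"]
    by simp
  then have "k x = k y"
    using s(1) by (simp add: of_real_divide[symmetric] del: of_real_divide)
  then show ?thesis using x y by auto
qed

text \<open>At a joint point of \<open>g\<close> and this square, \<open>g x = log_phi g\<close>, so
  the square is 0 there. In this form the conditions for several \<open>g\<close> can be
  added.\<close>

lemma log_phi_square_dist:
  assumes "g \<in> real_elements"
  shows "log_phi (\<lambda>x. (g x - log_phi g)\<^sup>2) = 0"
  using log_phi_joint_value[OF assms real_square_dist[OF assms], of "log_phi g"] by auto

lemma log_phi_sum_square_dist: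
  assumes "finite S" "S \<subseteq> real_elements"
  shows "(\<lambda>x. \<Sum>g\<in>S. (g x - log_phi g)\<^sup>2) \<in> real_elements \<and>
    log_phi (\<lambda>x. \<Sum>g\<in>S. (g x - log_phi g)\<^sup>2) = 0"
  using assms
proof (induction S rule: finite_induct)
  case empty
  then show ?case
    using real_const[of 0] log_phi_joint_value[of "\<lambda>_. 0" "\<lambda>_. 0"] by auto
next
  case (insert g S)
  then have g: "g \<in> real_elements" by simp
  show ?case
    using insert log_phi_add[OF real_square_dist[OF g]] real_add[OF real_square_dist[OF g]]
      log_phi_square_dist[OF g] by simp
qed

lemma ex_point_log_phi: "\<exists>x\<^sub>0. \<forall>g\<in>real_elements. log_phi g = g x\<^sub>0"
proof -
  have "UNIV \<inter> (\<Inter>g\<in>real_elements. {x. g x = log_phi g}) \<noteq> {}"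
  proof (rule compact_imp_fip_image[OF compact_space])
    show "closed {x. g x = log_phi g}" if "g \<in> real_elements" for g
      by (intro closed_Collect_eq real_continuous that continuous_on_const)
    fix S assume S: "finite S" "S \<subseteq> real_elements"
    let ?p = "\<lambda>x. \<Sum>g\<in>S. (g x - log_phi g)\<^sup>2"
    \<comment> \<open>\<open>log_phi ?p\<close> is 0 and also a value of \<open>?p\<close>; a
      vanishing sum of squares makes every term vanish.\<close>
    obtain x where "?p x = 0"
      using log_phi_sum_square_dist[OF S] log_phi_joint_value[of ?p ?p] by auto
    then have "\<forall>g\<in>S. g x = log_phi g"
      using S by (simp add: sum_nonneg_eq_0_iff)
    then show "UNIV \<inter> (\<Inter>g\<in>S. {x. g x = log_phi g}) \<noteq> {}" by blast
  qed
  then show ?thesis by fastforce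
qed

text \<open>
  Multiplying by \<open>exp (s k)\<close> with \<open>k\<close> peaking at \<open>x\<^sub>0\<close> and \<open>s \<rightarrow> \<plusminus>\<infinity>\<close> forces the point at which
  \<open>\<phi>\<close> takes its value to approach \<open>x\<^sub>0\<close>.
\<close>

lemma phi_positive:
  assumes x0: "\<And>g. g \<in> real_elements \<Longrightarrow> log_phi g = g x\<^sub>0"
    and p: "p \<in> real_elements" and e: "e > 0" "\<And>x. e \<le> p x"
  shows "\<phi> (\<lambda>x. complex_of_real (p x)) = complex_of_real (p x\<^sub>0)"
proof -
  obtain y where y: "\<phi> (\<lambda>x. complex_of_real (p x)) = complex_of_real (p y)"
    using value_in_range[OF real_memD[OF p]] by blast
  have c: "p y > 0" using e(1) e(2)[of y] by simp
  \<comment> \<open>Because \<open>k x\<^sub>0 = 1\<close>, \<open>\<phi>\<close> maps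
    \<open>p * exp (s * k)\<close> to \<open>p y * exp s\<close>, which must be one of its
    values.\<close>
  have test: "\<exists>x. p y * exp s = p x * exp (s * k x)"
    if k: "k \<in> real_elements" "k x\<^sub>0 = 1" for k s
  proof -
    have sk: "(\<lambda>x. s * k x) \<in> real_elements"
      using real_mult[OF real_const k(1)] .
    have E: "(\<lambda>x. exp (complex_of_real (s * k x))) \<in> A"
      by (rule exp_closed[OF real_memD[OF sk]])
    have "(\<lambda>x. complex_of_real (p x) * exp (complex_of_real (s * k x))) \<in> A"
      using mult_closed[OF real_memD[OF p] E] by (simp add: times_fun_def)
    then obtain x where "\<phi> (\<lambda>x. complex_of_real (p x) * exp (complex_of_real (s * k x)))
        = complex_of_real (p x) * exp (complex_of_real (s * k x))"
      using value_in_range by blast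
    then have "complex_of_real (p y * exp s) = complex_of_real (p x * exp (s * k x))"
      using phi_mult[OF real_memD[OF p] E] phi_exp[OF sk] x0[OF sk] k(2) y
      by (simp add: exp_of_real[symmetric])
    then show ?thesis by (metis of_real_eq_iff)
  qed
  have closed: "closed {x. p y \<le> p x}" "closed {x. p x \<le> p y}"
    by (intro closed_Collect_le continuous_on_const real_continuous p)+
  have "\<not> p x\<^sub>0 < p y"
  proof
    assume less: "p x\<^sub>0 < p y"
    obtain k where k: "k \<in> real_elements" "\<And>x. 0 \<le> k x" "\<And>x. k x \<le> 1"
      "\<And>x. p y \<le> p x \<Longrightarrow> k x = 0" "\<And>x. x \<in> {x\<^sub>0} \<Longrightarrow> k x = 1"
      by (rule real_urysohn[OF closed(1), of "{x\<^sub>0}"]) (use less in auto)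
    define B where "B = nrm (\<lambda>x. complex_of_real (p x))"
    have B: "p x \<le> B" for x
      using real_abs_le[OF p, of x] by (simp add: B_def)
    \<comment> \<open>\<open>exp s > s\<close> gives \<open>p y * exp s > B\<close>, which excludes
      points with \<open>k x = 0\<close>; where \<open>p x < p y\<close>, the bound
      \<open>k x \<le> 1\<close> leaves the right-hand side too small.\<close>
    define s where "s = B / p y"
    have s: "s > 0" using c B[of y] by (simp add: s_def)
    have "B < p y * exp s"
      using c exp_gt_self[of s] by (simp add: s_def pos_divide_less_eq mult.commute)
    obtain x where x: "p y * exp s = p x * exp (s * k x)"
      using test[of k s] k by auto
    show False
    proof (cases "p y \<le> p x")
      case True
      then show False using x k(4)[OF True] B[of x] \<open>B < p y * exp s\<close> by simp
    next
      case False
      have "p x * exp (s * k x) \<le> p x * exp s"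
        using s k(3)[of x] e(1) e(2)[of x] by (intro mult_left_mono) auto
      also have "\<dots> < p y * exp s" using False by simp
      finally show False using x by simp
    qed
  qed
  moreover have "\<not> p y < p x\<^sub>0"
  proof
    assume less: "p y < p x\<^sub>0"
    obtain k where k: "k \<in> real_elements" "\<And>x. 0 \<le> k x" "\<And>x. k x \<le> 1"
      "\<And>x. p x \<le> p y \<Longrightarrow> k x = 0" "\<And>x. x \<in> {x\<^sub>0} \<Longrightarrow> k x = 1"
      by (rule real_urysohn[OF closed(2), of "{x\<^sub>0}"]) (use less in auto)
    \<comment> \<open>Now \<open>exp s > s\<close> gives \<open>p y * exp (- s) < e\<close>, below
      every value of \<open>p\<close>, which again excludes points with
      \<open>k x = 0\<close>.\<close>
    define s where "s = p y / e"
    have s: "s > 0" using c e by (simp add: s_def)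
    have "p y * exp (- s) < e"
      using e exp_gt_self[of s] by (simp add: s_def exp_minus divide_simps mult.commute)
    obtain x where x: "p y * exp (- s) = p x * exp (- s * k x)"
      using test[of k "- s"] k by auto
    show False
    proof (cases "p x \<le> p y")
      case True
      then show False using x k(4)[OF True] e(2)[of x] \<open>p y * exp (- s) < e\<close> by simp
    next
      case False
      then have "p y * exp (- s) < p x * exp (- s)" by simp
      also have "\<dots> \<le> p x * exp (- s * k x)"
        using s k(3)[of x] e(1) e(2)[of x] by (intro mult_left_mono) auto
      finally show False using x by simp
    qed
  qed
  ultimately show ?thesis using y by simp
qed

lemma evaluation_if_continuous:
  assumes cont: "norm_continuous_on A nrm \<phi>"
  shows "\<exists>x\<^sub>0. \<forall>f\<in>A. \<phi> f = f x\<^sub>0"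
proof -
  obtain x\<^sub>0 where x0: "\<And>g. g \<in> real_elements \<Longrightarrow> log_phi g = g x\<^sub>0"
    using ex_point_log_phi by blast
  have "\<phi> (\<lambda>x. complex_of_real (k x)) = complex_of_real (k x\<^sub>0)"
    if k: "k \<in> real_elements" and nonneg: "\<And>x. 0 \<le> k x" for k
  proof -
    let ?k = "\<lambda>x. complex_of_real (k x)"
    have "cmod (\<phi> ?k - complex_of_real (k x\<^sub>0)) \<le> e" if e: "e > 0" for e
    proof -
      obtain d where d: "d > 0" "\<And>g. g \<in> A \<Longrightarrow> nrm (g - ?k) < d \<Longrightarrow> cmod (\<phi> g - \<phi> ?k) < e / 2"
        using cont real_memD[OF k] e unfolding norm_continuous_on_def by (meson half_gt_zero)
      \<comment> \<open>\<open>k + r\<close> is bounded below by \<open>r\<close>, so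
        \<open>phi_positive\<close> applies to it. The first bound controls the error at
        \<open>x\<^sub>0\<close>, the second the distance \<open>r * nrm 1\<close> from
        \<open>k\<close>, where \<open>nrm 1\<close> need not be 1.\<close>
      define r where "r = min (e / 2) (d / (nrm 1 + 1))"
      have n1: "nrm 1 \<ge> 0" by (rule nrm_nonneg[OF one_closed])
      have r: "r > 0" using e d n1 by (simp add: r_def)
      have r_le: "r \<le> e / 2" unfolding r_def by (rule min.cobounded1)
      have "r * (nrm 1 + 1) \<le> d"
        using n1 by (simp add: pos_le_divide_eq[symmetric] r_def)
      then have "r * nrm 1 < d" using r by (simp add: distrib_left)
      define g where "g = (\<lambda>x. complex_of_real (k x + r))"
      have kr: "(\<lambda>x. k x + r) \<in> real_elements" by (rule real_add[OF k real_const])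
      have "g - ?k = fun_scale (of_real r) 1"
        by (simp add: g_def fun_eq_iff fun_scale_def)
      then have "nrm (g - ?k) < d"
        using \<open>r * nrm 1 < d\<close> r by (simp add: nrm_scale one_closed)
      moreover have "g \<in> A" unfolding g_def by (rule real_memD[OF kr])
      ultimately have "cmod (\<phi> g - \<phi> ?k) < e / 2" by (intro d)
      moreover have "\<phi> g = complex_of_real (k x\<^sub>0 + r)"
        unfolding g_def by (rule phi_positive[OF x0 kr r]) (use nonneg in auto)
      ultimately have "cmod (complex_of_real (k x\<^sub>0 + r) - \<phi> ?k) < e / 2" by simp
      moreover have "cmod (complex_of_real (k x\<^sub>0 + r) - complex_of_real (k x\<^sub>0)) \<le> e / 2"
        using r r_le by simp
      ultimately have "cmod ((complex_of_real (k x\<^sub>0 + r) - complex_of_real (k x\<^sub>0))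
          - (complex_of_real (k x\<^sub>0 + r) - \<phi> ?k)) \<le> e"
        using norm_triangle_ineq4[of "complex_of_real (k x\<^sub>0 + r) - complex_of_real (k x\<^sub>0)"
            "complex_of_real (k x\<^sub>0 + r) - \<phi> ?k"] by linarith
      then show ?thesis by (simp add: algebra_simps)
    qed
    then have "cmod (\<phi> ?k - complex_of_real (k x\<^sub>0)) \<le> 0"
      by (rule field_le_epsilon) simp
    then show ?thesis by simp
  qed
  then show ?thesis using evaluation_if_nonzero_on_peaks[of x\<^sub>0] by force
qed

end

theorem theorem3p10:
  fixes A :: "('a::metric_space \<Rightarrow> complex) set"
    and nrm :: "('a \<Rightarrow> complex) \<Rightarrow> real"
    and \<phi> :: "('a \<Rightarrow> complex) \<Rightarrow> complex"
  assumes "natural_banach_function_algebra A nrm"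
    and "\<And>F K :: 'a set. closed F \<Longrightarrow> closed K \<Longrightarrow> F \<inter> K = {} \<Longrightarrow>
      \<exists>h\<in>A. range h \<subseteq> complex_of_real ` {0..1} \<and> (\<forall>x\<in>F. h x = 0) \<and> (\<forall>x\<in>K. h x = 1)"
    and "multiplicative_on A \<phi>"
    and "spectral_on A \<phi>"
    and "norm_continuous_on A nrm \<phi> \<or> 1 \<notin> cfun.span (kernel_on A \<phi>)"
  shows "\<exists>x\<^sub>0. (\<forall>f\<in>invertibles A. \<phi> f = f x\<^sub>0) \<and>
    (\<forall>f\<in>A. (\<lambda>x. cnj (f x)) \<in> A \<longrightarrow> \<phi> f = f x\<^sub>0)"
proof -
  interpret natural_banach_function_algebra A nrm by fact
  interpret regular_spectral_functional A nrm \<phi>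
    by unfold_locales (fact assms)+
  have "\<exists>x\<^sub>0. \<forall>f\<in>A. \<phi> f = f x\<^sub>0"
    using assms(5) evaluation_if_continuous evaluation_if_one_notin_span_kernel by blast
  then show ?thesis by (auto simp: invertibles_def)
qed

end
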